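(* Let $1\le n\le N$ be integers, let $\psi_0\in\mathbb{C}^{2^n}$ be a unit vector, and let $H_j=\mathrm{diag}(k^{(j)}_1,\dots,k^{(j)}_{2^n})$, $j=1,\dots,N$, be linearly independent diagonal matrices with integer entries. Let $U(\boldsymbol{\theta})=e^{i(\theta_1H_1+\dots+\theta_NH_N)}$ for $\boldsymbol{\theta}\in[-\pi,\pi]^N$. Let $K$, $V_U$, $\mathcal{F}_{\text{Haar}}$ and $\mathcal{E}_U$ be as in the context. Define the approximate expressiveness by $$\tilde{\mathcal{E}}_U(t)=\frac{\sqrt{\det(\mathrm{Var}(K))}}{V_U}\,(4\pi t)^{N/2}\,\mathcal{F}_{\text{Haar}}(t).$$ Then there exists a positive constant $c$ such that $|\tilde{\mathcal{E}}_U(t)-\mathcal{E}_U(t)|<c\,t^{\frac N2-2^n}$ for all integers $t>0$.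
   Context: With fidelity $F_U(\boldsymbol{\theta},\boldsymbol{\theta}')=|\langle\psi_0|U(\boldsymbol{\theta})^\dagger U(\boldsymbol{\theta}')|\psi_0\rangle|^2$, the frame potential is $$\mathcal{F}_U(t)=\frac{1}{(2\pi)^{2N}}\int_{[-\pi,\pi]^{2N}}F_U(\boldsymbol{\theta},\boldsymbol{\theta}')^t\,d\boldsymbol{\theta}\,d\boldsymbol{\theta}'.$$ Further, $\mathcal{F}_{\text{Haar}}(t)=\binom{2^n+t-1}{2^n-1}^{-1}$, and the expressiveness is $\mathcal{E}_U(t)=\mathcal{F}_{\text{Haar}}(t)/\mathcal{F}_U(t)$. For $x=1,\dots,2^n$ let $\boldsymbol{k}_x=(k^{(1)}_x,\dots,k^{(N)}_x)\in\mathbb{Z}^N$, let $|x\rangle$ denote the $x$-th standard basis vector of $\mathbb{C}^{2^n}$, and let $\boldsymbol{\Omega}=\{\boldsymbol{k}_x: x=1,\dots,2^n\}$. Let $X$ be a random index with $\mathbb{P}(X=x)=|\langle\psi_0|x\rangle|^2$, and let $K=\boldsymbol{k}_X$, so that $\langle\psi_0|U(\boldsymbol{\theta})|\psi_0\rangle=\mathbb{E}\,e^{i\boldsymbol{\theta}\cdot K}$; $\mathrm{Var}(K)\in\mathbb{R}^{N\times N}$ is the covariance matrix of $K$. Let $\boldsymbol{\Delta}=\{\boldsymbol{k}-\boldsymbol{k}':\boldsymbol{k},\boldsymbol{k}'\in\boldsymbol{\Omega}\}$. The random walk is $W_t=D_1+\dots+D_t$, where the $D_s$ are independent and distributed as $K-K'$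 with $K'$ an independent copy of $K$. Its lattice is $\mathrm{lat}(W)=\mathrm{span}_{\mathbb{Z}}(\boldsymbol{\Delta})\subseteq\mathbb{Z}^N$. The volume of this lattice is $V_U=|\det(\boldsymbol{\Delta}^* )|$, where $\boldsymbol{\Delta}^*$ is an $N\times N$ matrix whose rows are selected from $\boldsymbol{\Delta}$ and whose row space over the integers equals $\mathrm{lat}(W)$.
   Formalization: It is assumed that the walk's positive-probability steps generate all of span_Z(Δ) (this can fail if ψ₀ has zero components, e.g. H=diag(0,1), ψ₀=e₁, where the bound is false) and that det(Δ* )≠0, since V_U is divided by. *)

theory Defs
  imports "HOL-Analysis.Analysis" "HOL-Probability.Probability"
begin

text \<open>
  The Hilbert space \<open>\<complex>\<^bsup>2^n\<^esup>\<close> is \<open>complex ^ 'd\<close> with \<open>CARD('d) = 2 ^ n\<close>, and the number of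
  parameters \<open>N\<close> is \<open>CARD('N)\<close>.  The diagonal integer matrices are given by
  \<open>k :: 'd \<Rightarrow> int ^ 'N\<close>, where \<open>k x $ j\<close> is the \<open>x\<close>-th diagonal entry of \<open>H\<^sub>j\<close>.
\<close>

subsection \<open>The circuit and its expressiveness\<close>

definition cinner :: "complex ^ 'd \<Rightarrow> complex ^ 'd \<Rightarrow> complex" where
  "cinner u v = (\<Sum>x\<in>UNIV. cnj (u $ x) * v $ x)"

definition adjoint_mat :: "complex ^ 'd ^ 'd \<Rightarrow> complex ^ 'd ^ 'd" where
  "adjoint_mat A = (\<chi> x y. cnj (A $ y $ x))"

definition cscale_mat :: "complex \<Rightarrow> complex ^ 'd ^ 'd \<Rightarrow> complex ^ 'd ^ 'd" where
  "cscale_mat c A = (\<chi> x y. c * A $ x $ y)"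

text \<open>
  Square matrices are not an instance of \<^class>\<open>real_normed_algebra_1\<close> (products on the vector
  type are componentwise), so \<^const>\<open>exp\<close> is not the matrix exponential; it is given by its series.
\<close>

definition mat_exp :: "complex ^ 'd ^ 'd \<Rightarrow> complex ^ 'd ^ 'd" where
  "mat_exp A = (\<Sum>m. (1 / fact m) *\<^sub>R (((**) A ^^ m) (mat 1)))"

definition Ham :: "('d \<Rightarrow> int ^ 'N) \<Rightarrow> 'N \<Rightarrow> complex ^ 'd ^ 'd" where
  "Ham k j = (\<chi> x y. if x = y then of_int (k x $ j) else 0)"

definition circuit :: "('d \<Rightarrow> int ^ 'N) \<Rightarrow> real ^ 'N \<Rightarrow> complex ^ 'd ^ 'd" where
  "circuit k \<theta> = mat_exp (cscale_mat \<i> (\<Sum>j\<in>UNIV. (\<theta> $ j) *\<^sub>R Ham k j))"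

definition fidelity ::
  "complex ^ 'd \<Rightarrow> ('d \<Rightarrow> int ^ 'N) \<Rightarrow> real ^ 'N \<Rightarrow> real ^ 'N \<Rightarrow> real" where
  "fidelity \<psi> k \<theta> \<theta>' =
     (cmod (cinner \<psi> ((adjoint_mat (circuit k \<theta>) ** circuit k \<theta>') *v \<psi>)))\<^sup>2"

definition param_cube :: "(real ^ 'N) set" where
  "param_cube = cbox (\<chi> j. - pi) (\<chi> j. pi)"

definition frame_potential :: "complex ^ 'd \<Rightarrow> ('d \<Rightarrow> int ^ 'N) \<Rightarrow> nat \<Rightarrow> real" where
  "frame_potential \<psi> k t =
     1 / (2 * pi) ^ (2 * CARD('N)) *
     integral (param_cube \<times> param_cube) (\<lambda>(\<theta>, \<theta>'). fidelity \<psi> k \<theta> \<theta>' ^ t)"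

definition haar_frame_potential :: "nat \<Rightarrow> nat \<Rightarrow> real" where
  "haar_frame_potential n t = 1 / real ((2 ^ n + t - 1) choose (2 ^ n - 1))"

definition expressiveness ::
  "nat \<Rightarrow> complex ^ 'd \<Rightarrow> ('d \<Rightarrow> int ^ 'N) \<Rightarrow> nat \<Rightarrow> real" where
  "expressiveness n \<psi> k t = haar_frame_potential n t / frame_potential \<psi> k t"

subsection \<open>The random vector \<open>K\<close> and the random walk\<close>

text \<open>The weights sum to 1, so that \<^const>\<open>embed_pmf\<close> is meaningful, exactly when \<open>\<psi>\<close> is a
  unit vector.\<close>

definition index_pmf :: "complex ^ 'd \<Rightarrow> 'd pmf" where
  "index_pmf \<psi> = embed_pmf (\<lambda>x. (cmod (cinner \<psi> (axis x 1)))\<^sup>2)"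

definition K_pmf :: "complex ^ 'd \<Rightarrow> ('d \<Rightarrow> int ^ 'N) \<Rightarrow> (int ^ 'N) pmf" where
  "K_pmf \<psi> k = map_pmf k (index_pmf \<psi>)"

definition covariance_mat :: "(int ^ 'N) pmf \<Rightarrow> real ^ 'N ^ 'N" where
  "covariance_mat p = (\<chi> i j. measure_pmf.expectation p (\<lambda>v.
     (real_of_int (v $ i) - measure_pmf.expectation p (\<lambda>w. real_of_int (w $ i))) *
     (real_of_int (v $ j) - measure_pmf.expectation p (\<lambda>w. real_of_int (w $ j)))))"

definition step_pmf :: "complex ^ 'd \<Rightarrow> ('d \<Rightarrow> int ^ 'N) \<Rightarrow> (int ^ 'N) pmf" where
  "step_pmf \<psi> k = map_pmf (\<lambda>(v, w). v - w) (pair_pmf (K_pmf \<psi> k) (K_pmf \<psi> k))"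

lemma module_int_vec: "module ((*s) :: int \<Rightarrow> int ^ 'N \<Rightarrow> int ^ 'N)"
  by unfold_locales (simp_all add: vec_eq_iff algebra_simps)

definition int_span :: "(int ^ 'N) set \<Rightarrow> (int ^ 'N) set" where
  "int_span = module.span (*s)"

text \<open>
  The lattice of the walk is generated by the steps of positive probability; since \<open>0\<close> is such a
  step, it is also generated by all the sites that the walk started at \<open>0\<close> visits with positive
  probability.
\<close>

definition walk_lattice :: "complex ^ 'd \<Rightarrow> ('d \<Rightarrow> int ^ 'N) \<Rightarrow> (int ^ 'N) set" where
  "walk_lattice \<psi> k = int_span (set_pmf (step_pmf \<psi> k))"

text \<open>Here all indices \<open>x\<close> count, also those with \<open>\<psi> $ x = 0\<close>.\<close>

definition Delta :: "('d \<Rightarrow> int ^ 'N) \<Rightarrow> (int ^ 'N) set" where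
  "Delta k = {v - w | v w. v \<in> range k \<and> w \<in> range k}"

text \<open>The argument \<open>V\<close> is the volume of the lattice of the walk.\<close>

definition approx_expressiveness ::
  "nat \<Rightarrow> complex ^ 'd \<Rightarrow> ('d \<Rightarrow> int ^ 'N) \<Rightarrow> real \<Rightarrow> nat \<Rightarrow> real" where
  "approx_expressiveness n \<psi> k V t =
     sqrt (det (covariance_mat (K_pmf \<psi> k))) / V *
     (4 * pi * real t) powr (real CARD('N) / 2) * haar_frame_potential n t"

end

theory Submission
  imports Defs
begin

text \<open>
  The frame potential is the probability that the walk returns to the origin after \<open>t\<close> steps.
  Since every step is an integer combination of the rows of \<open>B\<close>, it can be computed for the walk of
  the coefficient vectors, whose lattice is all of \<open>\<int>\<^sup>N\<close>.  The characteristic function \<open>\<phi>\<close> of one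
  step of that walk is nonnegative and attains the value 1 on the cube \<open>[-\<pi>, \<pi>]\<^sup>N\<close> only at the
  origin, so \<open>\<phi> x \<le> exp (- c * (norm x)\<^sup>2)\<close> there for some \<open>c > 0\<close>.  As \<open>\<phi>\<close> is even, it differs from the
  Gaussian with the same covariance only by a term of fourth order; hence the error between the
  \<open>t\<close>-th powers is \<open>O(1/t)\<close> times a Gaussian, and the local limit theorem holds with relative error
  \<open>O(1/t)\<close>.  Finally \<open>haar_frame_potential n t\<close> is of order \<open>t\<close> to the power \<open>1 - 2 ^ n\<close>.
\<close>

subsection \<open>Linear substitution and Gaussian integrals\<close>

text \<open>In the original coordinates the characteristic function of a step equals 1 at every
  point that pairs all lattice vectors with multiples of 2 pi. If the lattice is a proper
  sublattice, the cube contains several such peaks, and a local analysis at the origin would miss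
  the others. In coefficient coordinates one peak is left, and the volume \<open>|det B|\<close>
  returns through the covariance: if \<Sigma> is the covariance of a step in these coordinates,
  twice the covariance of \<open>K\<close> is \<open>B^T \<Sigma> B\<close>. The factor two comes
  from taking the difference of two independent copies and turns 2 pi into the 4 pi of the
  statement. The expressiveness contains the reciprocal of the frame potential, and the bound is
  claimed for every t > 0. Asymptotics say nothing about small t; positivity of the frame potential
  makes these finitely many errors finite, and the constant absorbs them. The exponents N/2 - 1,
  from the error of the reciprocal, and 1 - 2^n, from the Haar factor, add up to N/2 - 2^n.\<close>

lemma prod_Basis_vec: "(\<Prod>b\<in>(Basis :: (real^'n) set). g b) = (\<Prod>i\<in>UNIV. g (axis i 1))"
proof -
  have Basis: "(Basis :: (real^'n) set) = range (\<lambda>i. axis i 1)"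
    by (auto simp: Basis_vec_def)
  have "inj (\<lambda>i::'n. axis i (1::real))"
    by (simp add: inj_on_def axis_eq_axis)
  then show ?thesis
    unfolding Basis by (subst prod.reindex) auto
qed

lemma borel_measurable_linear_vec:
  fixes f :: "real^'n \<Rightarrow> real^'n"
  assumes "linear f"
  shows "f \<in> borel_measurable borel"
  using assms by (intro borel_measurable_continuous_onI linear_continuous_on) (simp add: linear_conv_bounded_linear)

text \<open>A coordinate swap carries boxes to boxes with the same edge lengths up to order, and
  \<open>lborel\<close> is determined by its values on boxes.\<close>

lemma nn_integral_lborel_permute:
  fixes F :: "real^'n \<Rightarrow> ennreal" and m n :: 'n
  assumes [measurable]: "F \<in> borel_measurable borel"
  shows "(\<integral>\<^sup>+x. F (\<chi> i. x $ Transposition.transpose m n i) \<partial>lborel) = (\<integral>\<^sup>+x. F x \<partial>lborel)"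
proof -
  let ?p = "Transposition.transpose m n"
  let ?h = "\<lambda>x::real^'n. \<chi> i. x $ ?p i"
  have lin: "linear ?h"
    by (rule linearI) (simp_all add: vec_eq_iff)
  note [measurable] = borel_measurable_linear_vec[OF lin]
  have "lborel = distr lborel borel ?h"
  proof (rule lborel_eqI)
    fix l u :: "real^'n"
    assume le: "\<And>b. b \<in> Basis \<Longrightarrow> l \<bullet> b \<le> u \<bullet> b"
    have le': "l $ i \<le> u $ i" for i
      using le[of "axis i 1"] by (simp add: inner_axis)
    have pp: "?p (?p i) = i" for i by simp
    have all_p: "(\<forall>i. Q i) \<longleftrightarrow> (\<forall>i. Q (?p i))" for Q
      by (metis pp)
    have "?h -` box l u = box (?h l) (?h u)"
      unfolding set_eq_iff vimage_eq mem_box_cart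
      by (subst all_p) simp
    then have "emeasure (distr lborel borel ?h) (box l u) = emeasure lborel (box (?h l) (?h u))"
      by (simp add: emeasure_distr)
    also have "\<dots> = (\<Prod>b\<in>Basis. (?h u - ?h l) \<bullet> b)"
      by (rule emeasure_lborel_box) (auto simp: Basis_vec_def inner_axis le')
    also have "(\<Prod>b\<in>Basis. (?h u - ?h l) \<bullet> b) = (\<Prod>i\<in>UNIV. (u - l) $ ?p i)"
      by (simp add: prod_Basis_vec inner_axis)
    also have "\<dots> = (\<Prod>i\<in>UNIV. (u - l) $ i)"
      using prod.permute[OF permutes_swap_id, of m UNIV n "\<lambda>i. (u - l) $ i"] by (simp add: o_def)
    also have "\<dots> = (\<Prod>b\<in>Basis. (u - l) \<bullet> b)"
      by (simp add: prod_Basis_vec inner_axis)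
    finally show "emeasure (distr lborel borel ?h) (box l u) = (\<Prod>b\<in>Basis. (u - l) \<bullet> b)" .
  qed simp
  then have "(\<integral>\<^sup>+x. F x \<partial>lborel) = (\<integral>\<^sup>+x. F x \<partial>distr lborel borel ?h)"
    by metis
  then show ?thesis
    by (simp add: nn_integral_distr)
qed

text \<open>Fubini with coordinate \<open>m\<close> innermost: with the other coordinates frozen,
  the shear is a translation of a line.\<close>

lemma nn_integral_lborel_shear:
  fixes F :: "real^'n \<Rightarrow> ennreal" and m n :: 'n
  assumes [measurable]: "F \<in> borel_measurable borel" and "m \<noteq> n"
  shows "(\<integral>\<^sup>+x. F (\<chi> i. if i = m then x $ m + x $ n else x $ i) \<partial>lborel) = (\<integral>\<^sup>+x. F x \<partial>lborel)"
proof -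
  let ?h = "\<lambda>x::real^'n. \<chi> i. if i = m then x $ m + x $ n else x $ i"
  let ?s = "\<lambda>f. \<Sum>b\<in>(Basis :: (real^'n) set). f b *\<^sub>R b"
  let ?e = "axis m (1::real)"
  let ?I = "Basis - {?e}"
  have lin: "linear ?h"
    by (rule linearI) (auto simp: vec_eq_iff algebra_simps)
  note [measurable] = borel_measurable_linear_vec[OF lin]
  interpret product_sigma_finite "\<lambda>_ :: real^'n. lborel :: real measure"
    by standard
  have e: "?e \<in> Basis" and I: "insert ?e ?I = Basis" "finite ?I" "?e \<notin> ?I"
    by (auto simp: axis_in_Basis_iff)
  have s_nth: "?s f $ i = f (axis i 1)" for f i
  proof -
    have "?s f $ i = ?s f \<bullet> axis i 1" by (simp add: inner_axis)
    also have "\<dots> = f (axis i 1)"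
      by (simp add: axis_in_Basis_iff inner_sum_left inner_Basis if_distrib cong: if_cong)
    finally show ?thesis .
  qed
  have hs: "?h (?s (x(?e := y))) = ?s (x(?e := x (axis n 1) + y))" for x y
    unfolding vec_eq_iff vec_lambda_beta s_nth using \<open>m \<noteq> n\<close> by (auto simp: axis_eq_axis)
  have *: "(\<integral>\<^sup>+x. G x \<partial>lborel) =
      (\<integral>\<^sup>+x. (\<integral>\<^sup>+y. G (?s (x(?e := y))) \<partial>lborel) \<partial>Pi\<^sub>M ?I (\<lambda>_. lborel))"
    if [measurable]: "G \<in> borel_measurable borel" for G :: "real^'n \<Rightarrow> ennreal"
  proof -
    have "(\<integral>\<^sup>+x. G x \<partial>lborel) = (\<integral>\<^sup>+x. G (?s x) \<partial>Pi\<^sub>M Basis (\<lambda>_. lborel))"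
      by (subst lborel_eq) (simp add: nn_integral_distr)
    also have "\<dots> = (\<integral>\<^sup>+x. G (?s x) \<partial>Pi\<^sub>M (insert ?e ?I) (\<lambda>_. lborel))"
      by (simp only: I)
    also have "\<dots> = (\<integral>\<^sup>+x. (\<integral>\<^sup>+y. G (?s (x(?e := y))) \<partial>lborel) \<partial>Pi\<^sub>M ?I (\<lambda>_. lborel))"
      by (rule product_nn_integral_insert) (use I in \<open>auto simp only: \<open>insert ?e ?I = Basis\<close>, measurable\<close>)
    finally show ?thesis .
  qed
  have "(\<integral>\<^sup>+y. F (?h (?s (x(?e := y)))) \<partial>lborel) = (\<integral>\<^sup>+y. F (?s (x(?e := y))) \<partial>lborel)"
    (is "?l = ?r") for x
  proof -
    have [measurable]: "(\<lambda>y. F (?s (x(?e := y)))) \<in> borel_measurable borel"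
    proof -
      have "(\<lambda>y. ?s (x(?e := y))) \<in> borel_measurable borel"
        by (intro borel_measurable_sum borel_measurable_scaleR) (auto simp: fun_upd_def)
      then show ?thesis by measurable
    qed
    have "?r = (\<integral>\<^sup>+y. F (?s (x(?e := x (axis n 1) + 1 * y))) \<partial>lborel)"
      by (subst nn_integral_real_affine[where c = 1 and t = "x (axis n 1)"]) auto
    then show ?thesis by (simp only: hs mult_1)
  qed
  then show ?thesis
    by (simp add: *[of F] *[of "\<lambda>x. F (?h x)"])
qed

text \<open>Linear maps are compositions of elementary ones, and both sides are multiplicative under
  composition. Nonnegative integrals are used so that integrability later comes together with the
  value.\<close>

lemma nn_integral_lborel_linear:
  fixes f :: "real^'n \<Rightarrow> real^'n" and F :: "real^'n \<Rightarrow> ennreal"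
  assumes "linear f" and "det (matrix f) \<noteq> 0" and "F \<in> borel_measurable borel"
  shows "(\<integral>\<^sup>+x. F x \<partial>lborel) = ennreal \<bar>det (matrix f)\<bar> * (\<integral>\<^sup>+x. F (f x) \<partial>lborel)"
proof -
  \<comment> \<open>\<open>F\<close> is quantified inside \<open>P\<close> because the composition
    case applies the hypothesis on \<open>g\<close> to \<open>F\<close> composed with
    \<open>f\<close>.\<close>
  define P where "P f \<longleftrightarrow> (\<forall>F. det (matrix f) \<noteq> 0 \<longrightarrow> F \<in> borel_measurable borel \<longrightarrow>
    (\<integral>\<^sup>+x. F x \<partial>lborel) = ennreal \<bar>det (matrix f)\<bar> * (\<integral>\<^sup>+x. F (f x) \<partial>lborel))"
    for f :: "real^'n \<Rightarrow> real^'n"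
  have "P f"
  proof (rule induct_linear_elementary[OF \<open>linear f\<close>])
    fix f g :: "real^'n \<Rightarrow> real^'n"
    assume lin: "linear f" "linear g" and "P f" "P g"
    note [measurable] = lin[THEN borel_measurable_linear_vec]
    have det: "det (matrix (f \<circ> g)) = det (matrix f) * det (matrix g)"
      using lin by (simp add: matrix_compose det_mul)
    show "P (f \<circ> g)"
      unfolding P_def det
    proof (intro allI impI)
      fix F :: "real^'n \<Rightarrow> ennreal"
      assume d: "det (matrix f) * det (matrix g) \<noteq> 0" and [measurable]: "F \<in> borel_measurable borel"
      have "(\<integral>\<^sup>+x. F x \<partial>lborel) = ennreal \<bar>det (matrix f)\<bar> * (\<integral>\<^sup>+x. F (f x) \<partial>lborel)"
        by (rule \<open>P f\<close>[unfolded P_def, rule_format]) (use d in auto)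
      also have "(\<integral>\<^sup>+x. F (f x) \<partial>lborel) = ennreal \<bar>det (matrix g)\<bar> * (\<integral>\<^sup>+x. F (f (g x)) \<partial>lborel)"
        by (rule \<open>P g\<close>[unfolded P_def, rule_format, of "\<lambda>x. F (f x)"]) (use d in auto)
      finally show "(\<integral>\<^sup>+x. F x \<partial>lborel) =
          ennreal \<bar>det (matrix f) * det (matrix g)\<bar> * (\<integral>\<^sup>+x. F ((f \<circ> g) x) \<partial>lborel)"
        by (simp add: abs_mult ennreal_mult mult.assoc)
    qed
  next
    fix f :: "real^'n \<Rightarrow> real^'n" and i
    assume "linear f" and 0: "\<And>x. f x $ i = 0"
    then have "\<not> surj f"
      by (metis one_neq_zero surjE vec_component)
    then have "det (matrix f) = 0"
      using \<open>linear f\<close> det_nz_iff_inj linear_injective_imp_surjective by blast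
    then show "P f" by (simp add: P_def)
  next
    fix c :: "'n \<Rightarrow> real"
    let ?f = "\<lambda>x::real^'n. \<chi> i. c i * x $ i"
    have lin: "linear ?f"
      by (rule linearI) (auto simp: vec_eq_iff algebra_simps)
    note [measurable] = borel_measurable_linear_vec[OF lin]
    have det: "det (matrix ?f) = (\<Prod>i\<in>UNIV. c i)"
      by (subst det_diagonal) (auto simp: matrix_def axis_def)
    show "P ?f"
      unfolding P_def det
    proof (intro allI impI)
      fix F :: "real^'n \<Rightarrow> ennreal"
      assume nz: "(\<Prod>i\<in>UNIV. c i) \<noteq> 0" and [measurable]: "F \<in> borel_measurable borel"
      \<comment> \<open>\<open>lborel_affine_euclidean\<close> indexes scaling factors by basis
        vectors; \<open>c'\<close> transports the coordinate-indexed \<open>c\<close> to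
        them.\<close>
      define c' where "c' b = c (SOME i. b = axis i 1)" for b :: "real^'n"
      have c': "c' (axis i 1) = c i" for i
        by (simp add: c'_def axis_eq_axis)
      have f: "?f = (\<lambda>x. 0 + (\<Sum>j\<in>Basis. (c' j * (x \<bullet> j)) *\<^sub>R j))"
      proof (rule ext, subst euclidean_eq_iff, rule ballI)
        fix x b :: "real^'n" assume b: "b \<in> Basis"
        then obtain i where i: "b = axis i 1" by (auto simp: Basis_vec_def)
        have "(\<Sum>j\<in>Basis. (c' j * (x \<bullet> j)) *\<^sub>R j) \<bullet> b = c' b * (x \<bullet> b)"
          using b by (simp add: inner_sum_left inner_Basis if_distrib cong: if_cong)
        then show "?f x \<bullet> b = (0 + (\<Sum>j\<in>Basis. (c' j * (x \<bullet> j)) *\<^sub>R j)) \<bullet> b"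
          by (simp add: i c' inner_axis)
      qed
      have "lborel = density (distr lborel borel ?f) (\<lambda>_. (\<Prod>j\<in>(Basis :: (real^'n) set). \<bar>c' j\<bar>))"
        unfolding f by (rule lborel_affine_euclidean) (use nz in \<open>auto simp: Basis_vec_def c'\<close>)
      moreover have "(\<Prod>j\<in>(Basis :: (real^'n) set). \<bar>c' j\<bar>) = \<bar>\<Prod>i\<in>UNIV. c i\<bar>"
        by (simp add: prod_Basis_vec c' abs_prod)
      ultimately have "lborel = density (distr lborel borel ?f) (\<lambda>_. ennreal \<bar>\<Prod>i\<in>UNIV. c i\<bar>)"
        by simp
      then have "(\<integral>\<^sup>+x. F x \<partial>lborel) = (\<integral>\<^sup>+x. F x \<partial>density (distr lborel borel ?f) (\<lambda>_. ennreal \<bar>\<Prod>i\<in>UNIV. c i\<bar>))"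
        by metis
      then show "(\<integral>\<^sup>+x. F x \<partial>lborel) = ennreal \<bar>\<Prod>i\<in>UNIV. c i\<bar> * (\<integral>\<^sup>+x. F (?f x) \<partial>lborel)"
        by (simp add: nn_integral_density nn_integral_distr nn_integral_cmult)
    qed
  next
    fix m n :: 'n assume "m \<noteq> n"
    let ?h = "\<lambda>v::real^'n. \<chi> i. v $ Transposition.transpose m n i"
    have "matrix ?h = (\<chi> i. (mat 1 :: real^'n^'n) $ Transposition.transpose m n i)"
      by (auto simp: vec_eq_iff matrix_def axis_def mat_def)
    then have "\<bar>det (matrix ?h)\<bar> = 1"
      by (simp add: det_permute_rows permutes_swap_id sign_swap_id abs_mult)
    then show "P ?h"
      by (simp add: P_def nn_integral_lborel_permute)
  next
    fix m n :: 'n assume mn: "m \<noteq> n"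
    let ?h = "\<lambda>x::real^'n. \<chi> i. if i = m then x $ m + x $ n else x $ i"
    have "matrix ?h = (\<chi> k. if k = m then row m (mat 1) + 1 *s row n (mat 1) else row k (mat 1))"
      by (auto simp: vec_eq_iff matrix_def axis_def mat_def row_def)
    then have "det (matrix ?h) = 1"
      by (simp only: det_row_operation[OF mn] det_I)
    then show "P ?h"
      using mn by (simp add: P_def nn_integral_lborel_shear)
  qed
  then show ?thesis
    unfolding P_def using assms(2,3) by blast
qed

text \<open>The normal density of variance 1/(2 r) has mass one on the line. The product over the
  coordinates settles the identity matrix, and linear substitution contributes the
  determinant.\<close>

lemma has_bochner_integral_gaussian_vec:
  fixes M :: "real^'n^'n"
  assumes "det M \<noteq> 0" and "r > 0"
  shows "has_bochner_integral lborel (\<lambda>x. exp (- r * (norm (M *v x))\<^sup>2))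
           ((pi / r) powr (real CARD('n) / 2) / \<bar>det M\<bar>)"
proof (rule has_bochner_integral_nn_integral)
  have 1: "(\<integral>\<^sup>+y. exp (- r * y\<^sup>2) \<partial>lborel) = ennreal (sqrt (pi / r))"
  proof -
    have *: "normal_density 0 (sqrt (1 / (2 * r))) y = exp (- r * y\<^sup>2) / sqrt (pi / r)" for y
      using \<open>r > 0\<close> by (simp add: normal_density_def field_simps)
    have "(\<integral>\<^sup>+y. normal_density 0 (sqrt (1 / (2 * r))) y \<partial>lborel) = ennreal 1"
      by (subst nn_integral_eq_integral)
         (use \<open>r > 0\<close> in \<open>auto intro!: integrable_normal_density simp: integral_normal_density\<close>)
    then have "(\<integral>\<^sup>+y. ennreal (sqrt (pi / r)) * normal_density 0 (sqrt (1 / (2 * r))) y \<partial>lborel) = ennreal (sqrt (pi / r))"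
      by (subst nn_integral_cmult) auto
    then show ?thesis
      using \<open>r > 0\<close> by (simp add: * flip: ennreal_mult)
  qed
  have exp_prod: "exp (- r * (norm x)\<^sup>2) = (\<Prod>b\<in>Basis. exp (- r * (x \<bullet> b)\<^sup>2))" for x :: "real^'n"
    unfolding power2_norm_eq_inner euclidean_inner[of x x] exp_sum[OF finite_Basis, symmetric] sum_distrib_left
    by (simp add: power2_eq_square)
  have "(\<integral>\<^sup>+x. exp (- r * (norm (x::real^'n))\<^sup>2) \<partial>lborel) = (\<integral>\<^sup>+x. (\<Prod>b\<in>Basis. ennreal (exp (- r * (x \<bullet> b)\<^sup>2))) \<partial>(lborel :: (real^'n) measure))"
    unfolding exp_prod by (simp add: prod_ennreal)
  also have "\<dots> = ennreal (sqrt (pi / r)) ^ CARD('n)"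
    by (subst nn_integral_lborel_prod) (use 1 in auto)
  also have "\<dots> = ennreal ((pi / r) powr (real CARD('n) / 2))"
    using \<open>r > 0\<close> by (simp add: ennreal_power powr_half_sqrt[symmetric] powr_powr flip: powr_realpow)
  finally have "ennreal ((pi / r) powr (real CARD('n) / 2)) = ennreal \<bar>det M\<bar> * (\<integral>\<^sup>+x. exp (- r * (norm (M *v x))\<^sup>2) \<partial>lborel)"
    using nn_integral_lborel_linear[of "(*v) M" "\<lambda>x. ennreal (exp (- r * (norm x)\<^sup>2))"] assms by simp
  then have "ennreal (1 / \<bar>det M\<bar>) * ennreal ((pi / r) powr (real CARD('n) / 2)) =
      (ennreal (1 / \<bar>det M\<bar>) * ennreal \<bar>det M\<bar>) * (\<integral>\<^sup>+x. exp (- r * (norm (M *v x))\<^sup>2) \<partial>lborel)"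
    by (simp add: mult.assoc)
  also have "ennreal (1 / \<bar>det M\<bar>) * ennreal \<bar>det M\<bar> = 1"
    using assms by (simp flip: ennreal_mult)
  finally show "(\<integral>\<^sup>+x. exp (- r * (norm (M *v x))\<^sup>2) \<partial>lborel) = ennreal ((pi / r) powr (real CARD('n) / 2) / \<bar>det M\<bar>)"
    by (simp flip: ennreal_mult)
qed (use borel_measurable_linear_vec[of "(*v) M"] in \<open>auto\<close>)

subsection \<open>Laplace asymptotics\<close>

text \<open>A square root of a Gram matrix without spectral theory. The form is the pullback of the
  inner product under \<open>C\<close>, which maps into a space indexed by \<open>'e\<close>; the
  range of \<open>C\<close> has dimension at most that of the source, so an isometry brings it back
  and makes the factor square.\<close>

lemma quadratic_form_factor:
  fixes q :: "'e::finite \<Rightarrow> real" and v :: "'e \<Rightarrow> real^'n"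
  assumes "\<And>e. q e \<ge> 0"
  obtains M :: "real^'n^'n"
    where "\<And>x y. (M *v x) \<bullet> (M *v y) = (\<Sum>e\<in>UNIV. q e * (x \<bullet> v e) * (y \<bullet> v e))"
proof -
  define C :: "real^'n \<Rightarrow> real^'e" where "C x = (\<chi> e. sqrt (q e) * (x \<bullet> v e))" for x
  have C: "linear C"
    by (rule linearI) (auto simp: C_def vec_eq_iff inner_add_left algebra_simps)
  have "dim (range C) \<le> dim (UNIV :: (real^'n) set)"
    using C by (rule dim_image_le)
  then obtain f :: "real^'e \<Rightarrow> real^'n"
    where f: "linear f" and norm_f: "\<And>x. x \<in> range C \<Longrightarrow> norm (f x) = norm x"
    using isometry_subset_subspace[of "range C" "UNIV :: (real^'n) set"] C subspace_UNIV
    by (metis linear_subspace_image)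
  \<comment> \<open>The isometry is only known to preserve norms on \<open>range C\<close>;
    polarization inside this subspace gives inner products.\<close>
  have inner_f: "f (C x) \<bullet> f (C y) = C x \<bullet> C y" for x y
    unfolding dot_norm
    by (simp add: norm_f linear_add[OF f, symmetric] linear_add[OF C, symmetric])
  have lin: "linear (f \<circ> C)"
    using C f by (rule linear_compose)
  show ?thesis
  proof (rule that[of "matrix (f \<circ> C)"])
    fix x y
    have "(matrix (f \<circ> C) *v x) \<bullet> (matrix (f \<circ> C) *v y) = C x \<bullet> C y"
      using lin by (simp add: inner_f)
    also have "\<dots> = (\<Sum>e\<in>UNIV. (sqrt (q e) * (x \<bullet> v e)) * (sqrt (q e) * (y \<bullet> v e)))"
      unfolding inner_vec_def[of "C x"] by (simp add: C_def)
    also have "\<dots> = (\<Sum>e\<in>UNIV. q e * (x \<bullet> v e) * (y \<bullet> v e))"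
    proof (rule sum.cong)
      fix e
      have "sqrt (q e) * sqrt (q e) = q e" using assms by simp
      then show "(sqrt (q e) * (x \<bullet> v e)) * (sqrt (q e) * (y \<bullet> v e)) = q e * (x \<bullet> v e) * (y \<bullet> v e)"
        by (metis mult.assoc mult.left_commute)
    qed simp
    finally show "(matrix (f \<circ> C) *v x) \<bullet> (matrix (f \<circ> C) *v y) = (\<Sum>e\<in>UNIV. q e * (x \<bullet> v e) * (y \<bullet> v e))" .
  qed
qed

section \<open>Scalar inequalities for the Laplace method\<close>

lemma cos_quadratic_bound: "\<bar>cos x - (1 - x\<^sup>2 / 2)\<bar> \<le> x ^ 4 / 24" for x :: real
proof -
  \<comment> \<open>Order 4 rather than 3: the cubic coefficient vanishes, so the remainder is
    quartic with constant 1/4!.\<close>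
  obtain t where t: "cos x = (\<Sum>m<4. cos_coeff m * x ^ m) + (cos (t + 1/2 * real 4 * pi) / fact 4) * x ^ 4"
    using Maclaurin_cos_expansion[of x 4] by auto
  have "(\<Sum>m<4. cos_coeff m * x ^ m) = 1 - x\<^sup>2 / 2"
  proof -
    have "{..<4} = {0, 1, 2, 3 :: nat}" by auto
    then show ?thesis
      by (simp add: cos_coeff_def fact_numeral)
  qed
  then have "\<bar>cos x - (1 - x\<^sup>2 / 2)\<bar> = \<bar>cos (t + 1/2 * real 4 * pi)\<bar> / 24 * x ^ 4"
    unfolding t by (simp add: abs_mult fact_numeral)
  also have "\<dots> \<le> 1 / 24 * x ^ 4"
    by (intro mult_right_mono divide_right_mono abs_cos_le_one) auto
  finally show ?thesis by simp
qed

lemma exp_minus_linear_bound: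
  assumes "(y::real) \<ge> 0"
  shows "\<bar>exp (- y) - (1 - y)\<bar> \<le> y\<^sup>2"
proof -
  \<comment> \<open>The product equals 1 + y^3.\<close>
  have "1 \<le> (1 + y) * (1 - y + y\<^sup>2)"
    using assms by (simp add: algebra_simps power2_eq_square)
  also have "\<dots> \<le> exp y * (1 - y + y\<^sup>2)"
  proof (rule mult_right_mono)
    have "0 \<le> (y - 1/2)\<^sup>2 + 3/4" by simp
    then show "0 \<le> 1 - y + y\<^sup>2" by (simp add: power2_eq_square algebra_simps)
  qed simp
  finally have "exp (- y) \<le> 1 - y + y\<^sup>2"
    by (simp add: exp_minus field_simps)
  moreover have "1 - y \<le> exp (- y)"
    using exp_ge_add_one_self[of "- y"] by simp
  ultimately show ?thesis by simp
qed

text \<open>Telescoping. Keeping \<open>m ^ t\<close> instead of bounding it by 1 preserves the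
  Gaussian decay when \<open>m\<close> is a Gaussian value; one factor is lost against the exponent
  \<open>Suc t\<close>.\<close>

lemma power_diff_abs_bound:
  fixes a b m :: real
  assumes "0 \<le> a" "a \<le> m" "0 \<le> b" "b \<le> m"
  shows "\<bar>a ^ Suc t - b ^ Suc t\<bar> \<le> real (Suc t) * \<bar>a - b\<bar> * m ^ t"
proof (induction t)
  case (Suc t)
  have "\<bar>a ^ Suc (Suc t) - b ^ Suc (Suc t)\<bar> = \<bar>a * (a ^ Suc t - b ^ Suc t) + (a - b) * b ^ Suc t\<bar>"
    by (simp add: algebra_simps)
  also have "\<dots> \<le> a * \<bar>a ^ Suc t - b ^ Suc t\<bar> + \<bar>a - b\<bar> * b ^ Suc t"
    using assms abs_triangle_ineq[of "a * (a ^ Suc t - b ^ Suc t)" "(a - b) * b ^ Suc t"]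
    by (simp add: abs_mult)
  also have "\<dots> \<le> m * (real (Suc t) * \<bar>a - b\<bar> * m ^ t) + \<bar>a - b\<bar> * m ^ Suc t"
    by (intro add_mono mult_mono mult_left_mono power_mono Suc assms) (use assms in auto)
  also have "\<dots> = real (Suc (Suc t)) * \<bar>a - b\<bar> * m ^ Suc t"
    by (simp add: algebra_simps)
  finally show ?case .
qed simp

text \<open>Half of the decay pays for the polynomial factor: the quadratic Taylor term of exp (c u
  / 2) is c^2 u^2 / 8.\<close>

lemma square_exp_bound:
  fixes c u :: real
  assumes "c > 0" "u \<ge> 0"
  shows "u\<^sup>2 * exp (- c * u) \<le> 8 / c\<^sup>2 * exp (- c * u / 2)"
proof -
  have "(c * u / 2)\<^sup>2 / 2 \<le> exp (c * u / 2)"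
    using exp_lower_Taylor_quadratic[of "c * u / 2"] assms
      mult_nonneg_nonneg[of c u] by linarith
  then have "u\<^sup>2 \<le> 8 / c\<^sup>2 * exp (c * u / 2)"
    using assms by (simp add: field_simps power2_eq_square)
  then have "u\<^sup>2 * exp (- c * u) \<le> 8 / c\<^sup>2 * exp (c * u / 2) * exp (- c * u)"
    by (intro mult_right_mono) auto
  also have "\<dots> = 8 / c\<^sup>2 * exp (- c * u / 2)"
    by (simp flip: exp_add add: mult.assoc)
  finally show ?thesis .
qed

lemma mem_param_cube: "x \<in> param_cube \<longleftrightarrow> (\<forall>i. \<bar>x $ i\<bar> \<le> pi)"
  unfolding param_cube_def mem_box_cart by (simp add: abs_le_iff) (metis minus_le_iff)

lemma compact_param_cube: "compact param_cube"
  unfolding param_cube_def by (rule compact_cbox)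

text \<open>The hypothesis \<open>uniq\<close> is used twice: it makes the quadratic form
  nondegenerate, and by compactness it keeps \<phi> away from 1 off the origin. Near the origin the
  quadratic term outweighs the quartic error.\<close>

lemma cos_sum_laplace_estimates:
  fixes q :: "'e::finite \<Rightarrow> real" and v :: "'e \<Rightarrow> real^'n" and M :: "real^'n^'n"
  defines "\<phi> \<equiv> \<lambda>x. \<Sum>e\<in>UNIV. q e * cos (x \<bullet> v e)"
  assumes q: "\<And>e. q e \<ge> 0" and q1: "(\<Sum>e\<in>UNIV. q e) = 1"
    and uniq: "\<And>x. x \<in> param_cube \<Longrightarrow> \<phi> x = 1 \<Longrightarrow> x = 0"
    and M: "\<And>x. (norm (M *v x))\<^sup>2 = (\<Sum>e\<in>UNIV. q e * (x \<bullet> v e)\<^sup>2)"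
  shows "det M \<noteq> 0"
    and "\<exists>K>0. \<forall>x. \<bar>\<phi> x - exp (- (norm (M *v x))\<^sup>2 / 2)\<bar> \<le> K * norm x ^ 4"
    and "\<exists>c>0. (\<forall>x. exp (- (norm (M *v x))\<^sup>2 / 2) \<le> exp (- c * (norm x)\<^sup>2)) \<and>
                (\<forall>x\<in>param_cube. \<phi> x \<le> exp (- c * (norm x)\<^sup>2))"
proof -
  define Q where "Q x = (norm (M *v x))\<^sup>2" for x
  have Q: "Q x = (\<Sum>e\<in>UNIV. q e * (x \<bullet> v e)\<^sup>2)" for x
    unfolding Q_def by (rule M)
  have M0: "x = 0" if "M *v x = 0" for x
  proof (rule ccontr)
    assume "x \<noteq> 0"
    \<comment> \<open>A kernel vector scaled to length one lies in the cube, as 1 is below pi, and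
      every cosine of positive weight is 1 there, against \<open>uniq\<close>.\<close>
    define y where "y = (1 / norm x) *\<^sub>R x"
    have "Q x = 0" using that by (simp add: Q_def)
    then have "q e * (x \<bullet> v e)\<^sup>2 = 0" for e
      unfolding Q using sum_nonneg_eq_0_iff[of UNIV "\<lambda>e. q e * (x \<bullet> v e)\<^sup>2"] q by simp
    then have *: "q e = 0 \<or> x \<bullet> v e = 0" for e
      by simp
    have "q e * cos (y \<bullet> v e) = q e" for e
      using *[of e] by (auto simp: y_def)
    then have "\<phi> y = 1"
      unfolding \<phi>_def by (simp only: q1)
    moreover have "y \<in> param_cube"
    proof -
      have "norm y = 1" using \<open>x \<noteq> 0\<close> by (simp add: y_def)
      then have "\<bar>y $ i\<bar> \<le> 1" for i
        using component_le_norm_cart[of y i] by simp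
      then show ?thesis
        unfolding mem_param_cube using pi_gt3 by (meson less_imp_le order_trans one_le_numeral)
    qed
    ultimately have "y = 0" by (rule uniq[rotated])
    with \<open>x \<noteq> 0\<close> show False by (simp add: y_def)
  qed
  then have inj: "inj ((*v) M)"
    by (simp add: linear_injective_0)
  then show "det M \<noteq> 0"
    using det_nz_iff_inj[of "(*v) M"] by simp
  obtain B where B: "B > 0" "\<And>x. B * norm x \<le> norm (M *v x)"
    using linear_inj_bounded_below_pos[of "(*v) M"] inj by auto
  have QB: "B\<^sup>2 * (norm x)\<^sup>2 \<le> Q x" for x
    unfolding Q_def power_mult_distrib[symmetric] using B by (intro power_mono) auto

  define K2 where "K2 = (\<Sum>e\<in>UNIV. q e * (norm (v e))\<^sup>2)"
  define K4 where "K4 = (\<Sum>e\<in>UNIV. q e * norm (v e) ^ 4)"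
  have CS: "\<bar>x \<bullet> v e\<bar> \<le> norm x * norm (v e)" for x e
    by (rule Cauchy_Schwarz_ineq2)
  have Q_le: "Q x \<le> K2 * (norm x)\<^sup>2" for x
  proof -
    have "Q x \<le> (\<Sum>e\<in>UNIV. q e * ((norm x)\<^sup>2 * (norm (v e))\<^sup>2))"
      unfolding Q
    proof (intro sum_mono mult_left_mono q)
      fix e
      show "(x \<bullet> v e)\<^sup>2 \<le> (norm x)\<^sup>2 * (norm (v e))\<^sup>2"
        using power_mono[OF CS[of x e], of 2] by (simp add: power_mult_distrib)
    qed
    also have "\<dots> = K2 * (norm x)\<^sup>2"
      unfolding K2_def sum_distrib_right by (simp only: mult_ac)
    finally show ?thesis .
  qed
  have phi: "\<bar>\<phi> x - (1 - Q x / 2)\<bar> \<le> K4 / 24 * norm x ^ 4" for x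
  proof -
    have "\<phi> x - (1 - Q x / 2) = (\<Sum>e\<in>UNIV. q e * (cos (x \<bullet> v e) - (1 - (x \<bullet> v e)\<^sup>2 / 2)))"
      unfolding \<phi>_def Q
      by (simp add: algebra_simps sum.distrib sum_subtractf sum_divide_distrib q1)
    also have "\<bar>\<dots>\<bar> \<le> (\<Sum>e\<in>UNIV. q e * \<bar>cos (x \<bullet> v e) - (1 - (x \<bullet> v e)\<^sup>2 / 2)\<bar>)"
      by (rule order_trans[OF sum_abs]) (simp add: abs_mult q)
    also have "\<dots> \<le> (\<Sum>e\<in>UNIV. q e * (norm x ^ 4 * norm (v e) ^ 4 / 24))"
    proof (intro sum_mono mult_left_mono q)
      fix e
      have "(x \<bullet> v e) ^ 4 \<le> (norm x * norm (v e)) ^ 4"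
        using power_mono[OF CS[of x e], of 4] by simp
      then show "\<bar>cos (x \<bullet> v e) - (1 - (x \<bullet> v e)\<^sup>2 / 2)\<bar> \<le> norm x ^ 4 * norm (v e) ^ 4 / 24"
        using cos_quadratic_bound[of "x \<bullet> v e"] by (simp add: power_mult_distrib)
    qed
    also have "\<dots> = K4 / 24 * norm x ^ 4"
      unfolding K4_def sum_divide_distrib sum_distrib_right by (simp add: mult_ac)
    finally show ?thesis .
  qed
  have K4: "K4 \<ge> 0"
    unfolding K4_def by (intro sum_nonneg mult_nonneg_nonneg q) auto
  show "\<exists>K>0. \<forall>x. \<bar>\<phi> x - exp (- (norm (M *v x))\<^sup>2 / 2)\<bar> \<le> K * norm x ^ 4"
  proof (intro exI[of _ "K4 / 24 + K2\<^sup>2 / 4 + 1"] conjI allI)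
    show "K4 / 24 + K2\<^sup>2 / 4 + 1 > 0"
      using K4 by (simp add: add_nonneg_pos)
    fix x
    have "\<bar>exp (- (Q x / 2)) - (1 - Q x / 2)\<bar> \<le> (Q x / 2)\<^sup>2"
      by (rule exp_minus_linear_bound) (simp add: Q_def)
    also have "\<dots> \<le> (K2 * (norm x)\<^sup>2 / 2)\<^sup>2"
      using Q_le[of x] by (intro power_mono) (auto simp: Q_def)
    also have "\<dots> = K2\<^sup>2 / 4 * norm x ^ 4"
      by (simp add: power2_eq_square eval_nat_numeral)
    finally have "\<bar>\<phi> x - exp (- (Q x / 2))\<bar> \<le> (K4 / 24 + K2\<^sup>2 / 4) * norm x ^ 4"
      using phi[of x] unfolding distrib_right by linarith
    also have "\<dots> \<le> (K4 / 24 + K2\<^sup>2 / 4 + 1) * norm x ^ 4"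
      by (intro mult_right_mono) auto
    finally show "\<bar>\<phi> x - exp (- (norm (M *v x))\<^sup>2 / 2)\<bar> \<le> (K4 / 24 + K2\<^sup>2 / 4 + 1) * norm x ^ 4"
      by (simp add: Q_def)
  qed

  \<comment> \<open>For norms up to \<delta> the quartic error is at most B^2 |x|^2 / 24, less than
    the B^2 |x|^2 / 4 that the quadratic term can spare. The added 1 keeps the denominator
    positive.\<close>
  define \<delta> where "\<delta> = B / sqrt (K4 + 1)"
  have \<delta>: "\<delta> > 0" using B K4 by (simp add: \<delta>_def)
  have near: "\<phi> x \<le> 1 - B\<^sup>2 / 4 * (norm x)\<^sup>2" if "norm x \<le> \<delta>" for x
  proof -
    have "(norm x)\<^sup>2 \<le> \<delta>\<^sup>2" using that by (intro power_mono) auto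
    also have "\<delta>\<^sup>2 = B\<^sup>2 / (K4 + 1)" using K4 by (simp add: \<delta>_def power_divide)
    finally have "(K4 + 1) * (norm x)\<^sup>2 \<le> B\<^sup>2" using K4 by (simp add: field_simps)
    then have "K4 * (norm x)\<^sup>2 \<le> B\<^sup>2" using zero_le_power2[of "norm x"] unfolding distrib_right by linarith
    then have "K4 * (norm x)\<^sup>2 * (norm x)\<^sup>2 \<le> B\<^sup>2 * (norm x)\<^sup>2" by (intro mult_right_mono) auto
    moreover have "K4 * norm x ^ 4 = K4 * (norm x)\<^sup>2 * (norm x)\<^sup>2" by (simp add: eval_nat_numeral)
    ultimately have "K4 / 24 * norm x ^ 4 \<le> B\<^sup>2 * (norm x)\<^sup>2 / 24" by linarith
    moreover have "0 \<le> B\<^sup>2 * (norm x)\<^sup>2" by simp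
    ultimately show ?thesis using phi[of x] QB[of x] by linarith
  qed
  have cont: "continuous_on X \<phi>" for X
    unfolding \<phi>_def by (intro continuous_intros)
  obtain \<epsilon> where \<epsilon>: "\<epsilon> > 0" and far: "\<And>x. x \<in> param_cube \<Longrightarrow> \<delta> \<le> norm x \<Longrightarrow> \<phi> x \<le> 1 - \<epsilon>"
  proof -
    let ?S = "param_cube \<inter> {x :: real^'n. \<delta> \<le> norm x}"
    have "closed {x :: real^'n. \<delta> \<le> norm x}"
      by (intro closed_Collect_le continuous_intros)
    then have comp: "compact ?S"
      by (intro compact_Int_closed compact_param_cube)
    have le1: "\<phi> x \<le> 1" for x
      unfolding \<phi>_def q1[symmetric] using q by (intro sum_mono mult_left_le) auto
    show ?thesis
    proof (cases "?S = {}")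
      \<comment> \<open>The cube may lie inside the open \<delta>-ball; then any \<epsilon> will
        do.\<close>
      case True
      then show ?thesis by (intro that[of 1]) auto
    next
      case False
      then obtain z where z: "z \<in> ?S" "\<And>x. x \<in> ?S \<Longrightarrow> \<phi> x \<le> \<phi> z"
        using continuous_attains_sup[OF comp _ cont] by blast
      have "\<phi> z \<noteq> 1" using z(1) uniq[of z] \<delta> by auto
      then show ?thesis using z le1[of z] by (intro that[of "1 - \<phi> z"]) auto
    qed
  qed
  obtain R where R: "R > 0" "\<And>x. x \<in> param_cube \<Longrightarrow> norm (x :: real^'n) \<le> R"
    using compact_imp_bounded[OF compact_param_cube] unfolding bounded_pos by blast
  \<comment> \<open>The second entry makes c |x|^2 at most \<epsilon> on the whole cube, so that 1 -
    c |x|^2 bounds \<phi> in both regions.\<close>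
  define c where "c = min (B\<^sup>2 / 4) (\<epsilon> / R\<^sup>2)"
  have c: "c > 0" "c \<le> B\<^sup>2 / 4" "c * R\<^sup>2 \<le> \<epsilon>"
    using B \<epsilon> R by (auto simp: c_def min_def field_simps)
  show "\<exists>c>0. (\<forall>x. exp (- (norm (M *v x))\<^sup>2 / 2) \<le> exp (- c * (norm x)\<^sup>2)) \<and>
                (\<forall>x\<in>param_cube. \<phi> x \<le> exp (- c * (norm x)\<^sup>2))"
  proof (intro exI[of _ c] conjI allI ballI)
    fix x :: "real^'n"
    have *: "c * (norm x)\<^sup>2 \<le> B\<^sup>2 / 4 * (norm x)\<^sup>2"
      using c by (intro mult_right_mono) auto
    then show "exp (- (norm (M *v x))\<^sup>2 / 2) \<le> exp (- c * (norm x)\<^sup>2)"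
      using QB[of x] zero_le_power2[of "norm (M *v x)"] unfolding Q_def exp_le_cancel_iff by linarith
    assume x: "x \<in> param_cube"
    have "\<phi> x \<le> 1 - c * (norm x)\<^sup>2"
    proof (cases "norm x \<le> \<delta>")
      case True
      then show ?thesis using near[OF True] * by simp
    next
      case False
      have "c * (norm x)\<^sup>2 \<le> c * R\<^sup>2"
        using R(2)[OF x] c by (intro mult_left_mono power_mono) auto
      then show ?thesis using far[OF x] False c(3) by simp
    qed
    then show "\<phi> x \<le> exp (- c * (norm x)\<^sup>2)"
      using exp_ge_add_one_self[of "- c * (norm x)\<^sup>2"] by simp
  qed (use c in auto)
qed

text \<open>The indicator puts the cube and its complement under one bound that is integrable over
  the whole space, so truncating the Gaussian needs no separate estimate.\<close>

lemma cos_sum_laplace_pointwise: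
  fixes q :: "'e::finite \<Rightarrow> real" and v :: "'e \<Rightarrow> real^'n" and M :: "real^'n^'n"
  defines "\<phi> \<equiv> \<lambda>x. \<Sum>e\<in>UNIV. q e * cos (x \<bullet> v e)"
  assumes q: "\<And>e. q e \<ge> 0" and q1: "(\<Sum>e\<in>UNIV. q e) = 1"
    and nonneg: "\<And>x. \<phi> x \<ge> 0"
    and uniq: "\<And>x. x \<in> param_cube \<Longrightarrow> \<phi> x = 1 \<Longrightarrow> x = 0"
    and M: "\<And>x. (norm (M *v x))\<^sup>2 = (\<Sum>e\<in>UNIV. q e * (x \<bullet> v e)\<^sup>2)"
  shows "\<exists>C>0. \<exists>c>0. \<forall>t>0. \<forall>x.
    \<bar>indicator param_cube x * \<phi> x ^ t - exp (- (real t / 2) * (norm (M *v x))\<^sup>2)\<bar>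
      \<le> C / real t * exp (- (c * real t) * (norm x)\<^sup>2)"
proof -
  define b where "b x = exp (- (norm (M *v x))\<^sup>2 / 2)" for x
  have phi: "\<phi> x = (\<Sum>e\<in>UNIV. q e * cos (x \<bullet> v e))" for x
    by (simp add: \<phi>_def)
  note est = cos_sum_laplace_estimates[OF q q1 uniq[unfolded \<phi>_def] M, folded phi b_def]
  obtain K where K: "K > 0" "\<And>x. \<bar>\<phi> x - b x\<bar> \<le> K * norm x ^ 4"
    using est(2) by blast
  obtain c where c: "c > 0" "\<And>x. b x \<le> exp (- c * (norm x)\<^sup>2)"
      "\<And>x. x \<in> param_cube \<Longrightarrow> \<phi> x \<le> exp (- c * (norm x)\<^sup>2)"
    using est(3) by blast
  obtain R where R: "R > 0" "\<And>x. x \<in> param_cube \<Longrightarrow> norm (x :: real^'n) \<le> R"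
    using compact_imp_bounded[OF compact_param_cube] unfolding bounded_pos by blast
  \<comment> \<open>exp (c R^2) repays the factor lost in passing from exponent \<open>t\<close> to
    \<open>t - 1\<close>; the 1 covers the points outside the cube; 8 / c^2 comes from
    \<open>square_exp_bound\<close>.\<close>
  define C where "C = (K * exp (c * R\<^sup>2) + 1) * (8 / c\<^sup>2)"
  have bt: "exp (- (real t / 2) * (norm (M *v x))\<^sup>2) = b x ^ t" for t x
    unfolding b_def by (simp flip: exp_of_nat_mult)
  show ?thesis
  proof (rule exI[of _ C], intro conjI exI[of _ "c / 2"] allI impI)
    show "C > 0"
      unfolding C_def using K c by (intro mult_pos_pos add_pos_pos divide_pos_pos) auto
    fix t :: nat and x :: "real^'n"
    assume "t > 0"
    \<comment> \<open>The scale of the problem: the error t |x|^4 of the powers equals u^2 / t,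
      which is where the gain 1/t originates.\<close>
    define u where "u = real t * (norm x)\<^sup>2"
    have u: "u \<ge> 0" by (simp add: u_def)
    have et: "exp (- c * (norm x)\<^sup>2) ^ t = exp (- c * u)"
      by (simp add: u_def algebra_simps flip: exp_of_nat_mult)
    have key: "\<bar>indicator param_cube x * \<phi> x ^ t - b x ^ t\<bar> \<le> (K * exp (c * R\<^sup>2) + 1) * (u\<^sup>2 * exp (- c * u)) / real t"
    proof (cases "x \<in> param_cube")
      case True
      obtain s where s: "t = Suc s" using \<open>t > 0\<close> gr0_implies_Suc by blast
      have "\<bar>\<phi> x ^ t - b x ^ t\<bar> \<le> real t * \<bar>\<phi> x - b x\<bar> * exp (- c * (norm x)\<^sup>2) ^ s"
        unfolding s by (rule power_diff_abs_bound) (use nonneg c True in \<open>auto simp: b_def\<close>)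
      also have "\<dots> \<le> real t * (K * norm x ^ 4) * (exp (c * R\<^sup>2) * exp (- c * u))"
      proof (intro mult_mono mult_left_mono K)
        have "exp (- c * (norm x)\<^sup>2) ^ s = exp (c * (norm x)\<^sup>2) * exp (- c * u)"
          unfolding et[symmetric] s by (simp add: exp_minus field_simps)
        also have "\<dots> \<le> exp (c * R\<^sup>2) * exp (- c * u)"
          using R(2)[OF True] c by (intro mult_right_mono) (auto intro!: power_mono)
        finally show "exp (- c * (norm x)\<^sup>2) ^ s \<le> exp (c * R\<^sup>2) * exp (- c * u)" .
      qed (use K in auto)
      also have "\<dots> = K * exp (c * R\<^sup>2) * (u\<^sup>2 * exp (- c * u)) / real t"
        using \<open>t > 0\<close> by (simp add: u_def power2_eq_square eval_nat_numeral)
      also have "\<dots> \<le> (K * exp (c * R\<^sup>2) + 1) * (u\<^sup>2 * exp (- c * u)) / real t"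
        by (intro divide_right_mono mult_right_mono) auto
      finally show ?thesis using True by simp
    next
      case False
      \<comment> \<open>Outside the cube only the Gaussian remains, and u >= t >= 1 there, so the
        factor u^2 / t >= 1 can be inserted.\<close>
      then obtain i where "\<bar>x $ i\<bar> > pi" by (auto simp: mem_param_cube not_le)
      then have "norm x \<ge> 1" using component_le_norm_cart[of x i] pi_gt3 by linarith
      then have "(norm x)\<^sup>2 \<ge> 1" by simp
      then have "u \<ge> real t" using \<open>t > 0\<close> by (simp add: u_def)
      then have "u\<^sup>2 \<ge> (real t)\<^sup>2" by (intro power_mono) auto
      moreover have "(real t)\<^sup>2 \<ge> real t" using \<open>t > 0\<close> by (simp add: power2_eq_square)
      ultimately have "real t \<le> u\<^sup>2" by linarith
      then have "1 \<le> u\<^sup>2 / real t" using \<open>t > 0\<close> by simp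
      have "b x ^ t \<le> exp (- c * u)"
        unfolding et[symmetric] using c by (intro power_mono) (auto simp: b_def)
      also have "\<dots> \<le> u\<^sup>2 / real t * exp (- c * u)"
        using mult_right_mono[OF \<open>1 \<le> u\<^sup>2 / real t\<close>, of "exp (- c * u)"] by simp
      also have "\<dots> \<le> (K * exp (c * R\<^sup>2) + 1) * (u\<^sup>2 / real t * exp (- c * u))"
        using mult_right_mono[of 1 "K * exp (c * R\<^sup>2) + 1" "u\<^sup>2 / real t * exp (- c * u)"] K(1) by simp
      finally show ?thesis using False by (simp add: b_def)
    qed
    also have "\<dots> \<le> (K * exp (c * R\<^sup>2) + 1) * (8 / c\<^sup>2 * exp (- c * u / 2)) / real t"
      using square_exp_bound[OF c(1) u] K
      by (intro divide_right_mono mult_left_mono) auto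
    also have "\<dots> = C / real t * exp (- (c / 2 * real t) * (norm x)\<^sup>2)"
    proof -
      have "- c * u / 2 = - (c / 2 * real t) * (norm x)\<^sup>2" by (simp add: u_def)
      then show ?thesis
        by (simp only: C_def mult.assoc times_divide_eq_left)
    qed
    finally show "\<bar>indicator param_cube x * \<phi> x ^ t - exp (- (real t / 2) * (norm (M *v x))\<^sup>2)\<bar>
        \<le> C / real t * exp (- (c / 2 * real t) * (norm x)\<^sup>2)"
      unfolding bt .
  qed (use c in auto)
qed

lemma cos_sum_laplace:
  fixes q :: "'e::finite \<Rightarrow> real" and v :: "'e \<Rightarrow> real^'n"
  defines "\<phi> \<equiv> \<lambda>x. \<Sum>e\<in>UNIV. q e * cos (x \<bullet> v e)"
  defines "\<Sigma> \<equiv> \<chi> i j. \<Sum>e\<in>UNIV. q e * v e $ i * v e $ j"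
  assumes q: "\<And>e. q e \<ge> 0" and q1: "(\<Sum>e\<in>UNIV. q e) = 1"
    and nonneg: "\<And>x. \<phi> x \<ge> 0"
    and uniq: "\<And>x. x \<in> param_cube \<Longrightarrow> \<phi> x = 1 \<Longrightarrow> x = 0"
  shows "det \<Sigma> > 0"
    and "\<exists>C>0. \<forall>t>0. \<bar>integral param_cube (\<lambda>x. \<phi> x ^ t) -
            (2 * pi / real t) powr (real CARD('n) / 2) / sqrt (det \<Sigma>)\<bar>
          \<le> C * real t powr (- real CARD('n) / 2 - 1)"
proof -
  let ?N = "real CARD('n) / 2"
  obtain M :: "real^'n^'n"
    where M: "\<And>x y. (M *v x) \<bullet> (M *v y) = (\<Sum>e\<in>UNIV. q e * (x \<bullet> v e) * (y \<bullet> v e))"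
    using quadratic_form_factor[of q v] q by blast
  have norm_M: "(norm (M *v x))\<^sup>2 = (\<Sum>e\<in>UNIV. q e * (x \<bullet> v e)\<^sup>2)" for x
    unfolding power2_norm_eq_inner M by (simp add: power2_eq_square mult.assoc)
  \<comment> \<open>This turns the \<open>|det M|\<close> of the Gaussian integral into
    \<open>sqrt (det \<Sigma>)\<close>.\<close>
  have "\<Sigma> = transpose M ** M"
  proof -
    have "(transpose M ** M) $ i $ j = \<Sigma> $ i $ j" for i j
    proof -
      have "(transpose M ** M) $ i $ j = (M *v axis i 1) \<bullet> (M *v axis j 1)"
        by (simp add: matrix_matrix_mult_def matrix_vector_mult_basis column_def transpose_def inner_vec_def)
      also have "\<dots> = \<Sigma> $ i $ j"
        unfolding M \<Sigma>_def by (simp add: inner_axis')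
      finally show ?thesis .
    qed
    then show ?thesis by (simp add: vec_eq_iff)
  qed
  then have det\<Sigma>: "det \<Sigma> = (det M)\<^sup>2"
    by (simp add: det_mul det_transpose power2_eq_square)
  note hyps = q q1 uniq[unfolded \<phi>_def] norm_M
  have detM: "det M \<noteq> 0"
    by (rule cos_sum_laplace_estimates(1)[OF hyps])
  then show "det \<Sigma> > 0"
    by (simp add: det\<Sigma>)
  have phi: "\<phi> x = (\<Sum>e\<in>UNIV. q e * cos (x \<bullet> v e))" for x
    by (simp add: \<phi>_def)
  obtain C c where "C > 0" "c > 0" and
    pw: "\<And>t x. t > 0 \<Longrightarrow> \<bar>indicator param_cube x * \<phi> x ^ t - exp (- (real t / 2) * (norm (M *v x))\<^sup>2)\<bar>
      \<le> C / real t * exp (- (c * real t) * (norm x)\<^sup>2)"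
    using cos_sum_laplace_pointwise[OF q q1 nonneg[unfolded \<phi>_def] uniq[unfolded \<phi>_def] norm_M, folded phi]
    by blast
  have cont: "continuous_on param_cube (\<lambda>x. \<phi> x ^ t)" for t
    unfolding \<phi>_def by (intro continuous_intros)
  show "\<exists>C>0. \<forall>t>0. \<bar>integral param_cube (\<lambda>x. \<phi> x ^ t) -
            (2 * pi / real t) powr ?N / sqrt (det \<Sigma>)\<bar> \<le> C * real t powr (- real CARD('n) / 2 - 1)"
  proof (intro exI[of _ "C * (pi / c) powr ?N"] conjI allI impI)
    show "C * (pi / c) powr ?N > 0"
      using \<open>C > 0\<close> \<open>c > 0\<close> by simp
    fix t :: nat assume t: "t > 0"
    have i1: "set_integrable lborel param_cube (\<lambda>x. \<phi> x ^ t)"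
      unfolding set_integrable_def using borel_integrable_compact[OF compact_param_cube cont]
      by simp
    have I1: "has_bochner_integral lborel (\<lambda>x. indicator param_cube x * \<phi> x ^ t)
        (integral param_cube (\<lambda>x. \<phi> x ^ t))"
      using i1 set_borel_integral_eq_integral(2)[OF i1]
      by (simp add: set_integrable_def set_lebesgue_integral_def has_bochner_integral_iff)
    have I2: "has_bochner_integral lborel (\<lambda>x. exp (- (real t / 2) * (norm (M *v x))\<^sup>2))
        ((2 * pi / real t) powr ?N / \<bar>det M\<bar>)"
      using has_bochner_integral_gaussian_vec[OF detM, of "real t / 2"] t by (simp add: mult.commute)
    have I3: "has_bochner_integral lborel (\<lambda>x :: real^'n. C / real t * exp (- (c * real t) * (norm x)\<^sup>2))
        (C / real t * (pi / (c * real t)) powr ?N)"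
      using has_bochner_integral_gaussian_vec[of "mat 1 :: real^'n^'n" "c * real t"] t \<open>c > 0\<close>
      by (intro has_bochner_integral_mult_right) simp_all
    have "\<bar>integral param_cube (\<lambda>x. \<phi> x ^ t) - (2 * pi / real t) powr ?N / \<bar>det M\<bar>\<bar>
        \<le> C / real t * (pi / (c * real t)) powr ?N"
    proof -
      note D = has_bochner_integral_diff[OF I1 I2]
      have "norm (integral\<^sup>L lborel (\<lambda>x. indicator param_cube x * \<phi> x ^ t - exp (- (real t / 2) * (norm (M *v x))\<^sup>2)))
        \<le> integral\<^sup>L lborel (\<lambda>x :: real^'n. C / real t * exp (- (c * real t) * (norm x)\<^sup>2))"
        by (rule Bochner_Integration.integral_norm_bound_integral)
           (use D I3 pw[OF t] in \<open>auto simp: has_bochner_integral_iff\<close>)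
      then show ?thesis
        unfolding has_bochner_integral_integral_eq[OF D] has_bochner_integral_integral_eq[OF I3] by simp
    qed
    also have "\<dots> = C * (pi / c) powr ?N * real t powr (- real CARD('n) / 2 - 1)"
    proof -
      have "real t powr (- real CARD('n) / 2 - 1) = real t powr (- ?N - 1)" by simp
      also have "\<dots> = 1 / (real t powr ?N * real t)"
        using t unfolding powr_diff powr_minus by (simp add: field_simps)
      finally show ?thesis
        using t \<open>c > 0\<close> by (simp add: powr_divide powr_mult)
    qed
    finally show "\<bar>integral param_cube (\<lambda>x. \<phi> x ^ t) - (2 * pi / real t) powr ?N / sqrt (det \<Sigma>)\<bar>
        \<le> C * (pi / c) powr ?N * real t powr (- real CARD('n) / 2 - 1)"
      by (simp add: det\<Sigma>)
  qed
qed

subsection \<open>Trigonometric polynomials\<close>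

lemma integral_lborel_prod:
  fixes f :: "'a::euclidean_space \<Rightarrow> real \<Rightarrow> complex"
  assumes int: "\<And>b. b \<in> Basis \<Longrightarrow> integrable lborel (f b)"
  shows "(LINT x|lborel. (\<Prod>b\<in>Basis. f b (x \<bullet> b))) = (\<Prod>b\<in>Basis. LINT y|lborel. f b y)"
proof -
  interpret product_sigma_finite "\<lambda>_ :: 'a. lborel :: real measure"
    by standard
  have meas: "f b \<in> borel_measurable borel" if "b \<in> Basis" for b
    using borel_measurable_integrable[OF int[OF that]] by simp
  have "(LINT x|lborel. (\<Prod>b\<in>Basis. f b (x \<bullet> b))) =
      (LINT x|Pi\<^sub>M Basis (\<lambda>_. lborel). (\<Prod>b\<in>Basis. f b ((\<Sum>i\<in>Basis. x i *\<^sub>R i) \<bullet> b)))"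
    unfolding lborel_eq[where 'a = 'a]
    by (rule integral_distr) (auto intro!: borel_measurable_prod measurable_compose[OF _ meas])
  also have "\<dots> = (LINT x|Pi\<^sub>M Basis (\<lambda>_. lborel). (\<Prod>b\<in>Basis. f b (x b)))"
    by (simp add: inner_sum_left inner_Basis if_distrib cong: if_cong)
  also have "\<dots> = (\<Prod>b\<in>Basis. LINT y|lborel. f b y)"
    by (rule product_integral_prod) (use int in auto)
  finally show ?thesis .
qed

lemma integral_cis_int:
  "integral {-pi..pi} (\<lambda>y. cis (of_int k * y)) = (if k = 0 then of_real (2 * pi) else 0)"
proof (cases "k = 0")
  case False
  have "((\<lambda>y. cis (of_int k * y)) has_integral
      (cis (of_int k * pi) / (\<i> * of_int k) - cis (of_int k * (- pi)) / (\<i> * of_int k))) {-pi..pi}"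
  proof (rule fundamental_theorem_of_calculus)
    fix y
    have "((\<lambda>z. exp (\<i> * of_int k * z) / (\<i> * of_int k)) has_field_derivative
        exp (\<i> * of_int k * of_real y)) (at (of_real y))"
      using False by (auto intro!: derivative_eq_intros)
    then show "((\<lambda>y. cis (of_int k * y) / (\<i> * of_int k)) has_vector_derivative
        cis (of_int k * y)) (at y within {-pi..pi})"
      unfolding cis_conv_exp by (auto dest!: has_vector_derivative_real_field simp: mult.assoc)
  qed simp
  moreover have "cis (of_int k * pi) = cis (of_int k * (- pi))"
    by (simp add: complex_eq_iff sin_zero_iff_int2)
  ultimately show ?thesis
    using False by (simp add: integral_unique)
qed (simp add: scaleR_conv_of_real)

definition of_int_vec :: "int^'n \<Rightarrow> real^'n" where
  "of_int_vec s = (\<chi> i. of_int (s $ i))"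

lemma of_int_vec_nth [simp]: "of_int_vec s $ i = of_int (s $ i)"
  by (simp add: of_int_vec_def)

lemma of_int_vec_simps:
  "of_int_vec 0 = 0" "of_int_vec (s + r) = of_int_vec s + of_int_vec r"
  "of_int_vec (- s) = - of_int_vec s" "of_int_vec (s - r) = of_int_vec s - of_int_vec r"
  "of_int_vec s = 0 \<longleftrightarrow> s = 0"
  by (simp_all add: vec_eq_iff)

lemma cis_sum: "finite A \<Longrightarrow> cis (sum f A) = (\<Prod>a\<in>A. cis (f a))"
  by (induction A rule: finite_induct) (simp_all flip: cis_mult)

lemma integral_cis_param_cube:
  fixes s :: "int^'n"
  shows "integral param_cube (\<lambda>x. cis (of_int_vec s \<bullet> x)) =
    (if s = 0 then of_real (2 * pi) ^ CARD('n) else 0)"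
proof -
  \<comment> \<open>The indicator of the cube is distributed over the one-dimensional factors, which
    makes the integrand a product on the whole space.\<close>
  define f where "f b y = indicator {-pi..pi} y *\<^sub>R cis ((of_int_vec s \<bullet> b) * y)"
    for b :: "real^'n" and y :: real
  have cont: "continuous_on X (\<lambda>y. cis (c * y))" for X c
    by (intro continuous_intros)
  have int_f: "integrable lborel (f b)" for b
    unfolding f_def using cont by (intro borel_integrable_compact) auto
  have "continuous_on param_cube (\<lambda>x. cis (of_int_vec s \<bullet> x))"
    by (intro continuous_intros)
  then have int_cube: "set_integrable lborel param_cube (\<lambda>x. cis (of_int_vec s \<bullet> x))"
    unfolding set_integrable_def by (rule borel_integrable_compact[OF compact_param_cube])
  have "indicator param_cube x *\<^sub>R cis (of_int_vec s \<bullet> x) = (\<Prod>b\<in>Basis. f b (x \<bullet> b))" for x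
  proof (cases "x \<in> param_cube")
    case True
    then have "f b (x \<bullet> b) = cis ((of_int_vec s \<bullet> b) * (x \<bullet> b))" if "b \<in> Basis" for b
      using that by (auto simp: f_def Basis_vec_def inner_axis mem_param_cube abs_le_iff indicator_def minus_le_iff)
    then show ?thesis
      using True by (simp add: euclidean_inner[of "of_int_vec s" x] cis_sum)
  next
    case False
    then obtain i where "\<not> \<bar>x $ i\<bar> \<le> pi" by (auto simp: mem_param_cube)
    then have "f (axis i 1) (x \<bullet> axis i 1) = 0"
      by (auto simp: f_def inner_axis indicator_def)
    moreover have "axis i (1::real) \<in> Basis" by (simp add: axis_in_Basis_iff)
    ultimately have "(\<Prod>b\<in>Basis. f b (x \<bullet> b)) = 0"
      by (metis finite_Basis prod_zero)
    then show ?thesis using False by simp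
  qed
  then have "integral param_cube (\<lambda>x. cis (of_int_vec s \<bullet> x)) = (LINT x|lborel. (\<Prod>b\<in>Basis. f b (x \<bullet> b)))"
    unfolding set_borel_integral_eq_integral(2)[OF int_cube, symmetric] set_lebesgue_integral_def
    by simp
  also have "\<dots> = (\<Prod>b\<in>Basis. LINT y|lborel. f b y)"
    using int_f by (rule integral_lborel_prod)
  also have "\<dots> = (\<Prod>i\<in>UNIV. if s $ i = 0 then of_real (2 * pi) else 0)"
    unfolding prod_Basis_vec
  proof (rule prod.cong)
    fix i
    have "(LINT y|lborel. f (axis i 1) y) = (LINT y:{-pi..pi}|lborel. cis (of_int (s $ i) * y))"
      by (simp add: f_def set_lebesgue_integral_def inner_axis)
    also have "\<dots> = integral {-pi..pi} (\<lambda>y. cis (of_int (s $ i) * y))"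
      unfolding set_integrable_def
      by (rule set_borel_integral_eq_integral) (use cont in \<open>auto simp: set_integrable_def intro!: borel_integrable_compact\<close>)
    finally show "(LINT y|lborel. f (axis i 1) y) = (if s $ i = 0 then of_real (2 * pi) else 0)"
      by (simp add: integral_cis_int)
  qed simp
  also have "\<dots> = (if s = 0 then of_real (2 * pi) ^ CARD('n) else 0)"
    by (auto simp: vec_eq_iff prod_zero_iff)
  finally show ?thesis .
qed

text \<open>With only monomials and sums as constructors, an identity linear in the function has to
  be checked on single characters; products and powers are derived closure properties.\<close>

inductive trig_poly :: "(real^'n \<Rightarrow> complex) \<Rightarrow> bool" where
  monomial: "trig_poly (\<lambda>x. c * cis (of_int_vec s \<bullet> x))"
| add: "trig_poly f \<Longrightarrow> trig_poly g \<Longrightarrow> trig_poly (\<lambda>x. f x + g x)"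

lemma trig_poly_const: "trig_poly (\<lambda>x. c)"
  using monomial[of c 0] by (simp add: of_int_vec_simps)

lemma trig_poly_mult:
  assumes "trig_poly f" "trig_poly g"
  shows "trig_poly (\<lambda>x. f x * g x)"
  using assms(1)
proof induction
  case (monomial c s)
  from assms(2) show ?case
  proof induction
    case (monomial d r)
    have eq: "c * cis (of_int_vec s \<bullet> x) * (d * cis (of_int_vec r \<bullet> x)) = c * d * cis (of_int_vec (s + r) \<bullet> x)" for x
      by (simp add: of_int_vec_simps inner_add_left flip: cis_mult)
    show ?case unfolding eq by (rule trig_poly.monomial)
  next
    case (add f g)
    then show ?case by (simp add: distrib_left trig_poly.add)
  qed
next
  case (add f g)
  then show ?case by (simp add: distrib_right trig_poly.add)
qed

lemma trig_poly_power: "trig_poly f \<Longrightarrow> trig_poly (\<lambda>x. f x ^ t)"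
  by (induction t) (simp_all add: trig_poly_const trig_poly_mult)

lemma trig_poly_sum: "finite A \<Longrightarrow> (\<And>a. a \<in> A \<Longrightarrow> trig_poly (f a)) \<Longrightarrow> trig_poly (\<lambda>x. \<Sum>a\<in>A. f a x)"
  by (induction A rule: finite_induct) (simp_all add: trig_poly_const trig_poly.add)

lemma trig_poly_cos: "trig_poly (\<lambda>x. of_real (cos (x \<bullet> of_int_vec s)))"
proof -
  have eq: "of_real (cos (x \<bullet> of_int_vec s)) = 1/2 * cis (of_int_vec s \<bullet> x) + 1/2 * cis (of_int_vec (- s) \<bullet> x)" for x
    by (simp add: complex_eq_iff of_int_vec_simps inner_commute)
  show ?thesis unfolding eq by (intro trig_poly.intros)
qed

lemma continuous_on_trig_poly: "trig_poly f \<Longrightarrow> continuous_on X f"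
  by (induction rule: trig_poly.induct) (auto intro!: continuous_intros)

section \<open>Integer matrices acting on frequencies\<close>

abbreviation of_int_mat :: "int^'n^'m \<Rightarrow> real^'n^'m" where
  "of_int_mat B \<equiv> (\<chi> i j. of_int (B $ i $ j))"

lemma det_of_int_mat: "det (of_int_mat B) = of_int (det B)"
  by (simp add: det_def)

lemma of_int_vec_vector_matrix_mult: "of_int_vec (s v* B) = of_int_vec s v* of_int_mat B"
  by (simp add: vec_eq_iff vector_matrix_mult_def)

lemma of_int_mat_surj:
  assumes "det B \<noteq> 0"
  obtains \<theta> where "of_int_mat B *v \<theta> = \<eta>"
proof -
  have "invertible (of_int_mat B)"
    using assms by (simp add: invertible_det_nz det_of_int_mat)
  then show ?thesis
    using that by (metis invertible_def matrix_vector_mul_assoc matrix_vector_mul_lid)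
qed

text \<open>Solving \<open>B \<theta> = s\<close> over the reals makes the squared length of
  \<open>s\<close> equal to the pairing of \<open>s v* B\<close> with \<theta>.\<close>

lemma vector_matrix_mult_eq_0_iff:
  fixes B :: "int^'n^'n"
  assumes "det B \<noteq> 0"
  shows "s v* B = 0 \<longleftrightarrow> s = 0"
proof
  assume "s v* B = 0"
  obtain \<theta> where \<theta>: "of_int_mat B *v \<theta> = of_int_vec s"
    using assms by (rule of_int_mat_surj)
  have "of_int_vec s \<bullet> of_int_vec s = of_int_vec (s v* B) \<bullet> \<theta>"
    by (simp only: of_int_vec_vector_matrix_mult dot_lmul_matrix \<theta>)
  with \<open>s v* B = 0\<close> show "s = 0"
    by (simp add: of_int_vec_simps)
qed (simp add: vector_matrix_mult_def vec_eq_iff)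

text \<open>Both sides are multiples of the constant Fourier coefficient of \<open>f\<close>: composition with an
  injective integer matrix only relabels the frequencies.  This replaces a change of variables on
  the torus.\<close>

lemma trig_poly_double_integral:
  fixes B :: "int^'n^'n"
  assumes "trig_poly f" and detB: "det B \<noteq> 0"
  shows "integral (param_cube \<times> param_cube) (\<lambda>(\<theta>, \<theta>'). f (of_int_mat B *v (\<theta>' - \<theta>))) =
    of_real (2 * pi) ^ CARD('n) * integral param_cube f"
proof -
  define l u :: "real^'n" where "l = (\<chi> j. - pi)" and "u = (\<chi> j. pi)"
  have cube: "param_cube = cbox l u" "param_cube \<times> param_cube = cbox (l, l) (u, u)"
    by (auto simp: param_cube_def l_def u_def cbox_Pair_eq)
  have cont: "continuous_on X (\<lambda>z. f (of_int_mat B *v (snd z - fst z)))" if "trig_poly f" for X f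
    by (rule continuous_on_compose2[OF continuous_on_trig_poly[OF that, of UNIV]])
       (auto intro!: continuous_intros bounded_linear.continuous_on[OF matrix_vector_mul_bounded_linear])
  from assms(1) show ?thesis
  proof induction
    case (monomial c s)
    define r where "r = s v* B"
    define J where "J s = integral param_cube (\<lambda>x. cis (of_int_vec s \<bullet> x))" for s :: "int^'n"
    have B: "c * cis (of_int_vec s \<bullet> (of_int_mat B *v (\<theta>' - \<theta>))) =
        (c * cis (of_int_vec (- r) \<bullet> \<theta>)) * cis (of_int_vec r \<bullet> \<theta>')" for \<theta> \<theta>'
      unfolding r_def dot_lmul_matrix[symmetric] of_int_vec_vector_matrix_mult[symmetric]
      by (simp add: of_int_vec_simps inner_diff_right cis_mult mult.assoc)
    have "integral (param_cube \<times> param_cube)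
        (\<lambda>(\<theta>, \<theta>'). c * cis (of_int_vec s \<bullet> (of_int_mat B *v (\<theta>' - \<theta>)))) =
      integral (cbox l u) (\<lambda>\<theta>. integral (cbox l u) (\<lambda>\<theta>'. c * cis (of_int_vec s \<bullet> (of_int_mat B *v (\<theta>' - \<theta>)))))"
      unfolding cube(2) using cont[OF trig_poly.monomial]
      by (subst integral_prod_continuous) (simp_all add: case_prod_beta)
    also have "\<dots> = integral (cbox l u) (\<lambda>\<theta>. c * cis (of_int_vec (- r) \<bullet> \<theta>) * J r)"
      unfolding B J_def cube(1) by simp
    also have "\<dots> = c * J (- r) * J r"
      unfolding J_def cube(1) by simp
    \<comment> \<open>By orthogonality both sides vanish unless \<open>s = 0\<close>, which by
      injectivity is the same as \<open>r = 0\<close>; in that case every \<open>J\<close> is (2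
      pi)^N.\<close>
    also have "\<dots> = of_real (2 * pi) ^ CARD('n) * (c * J s)"
      using vector_matrix_mult_eq_0_iff[OF detB, of s]
      by (simp add: J_def integral_cis_param_cube r_def)
    finally show ?case
      by (simp add: J_def)
  next
    case (add f g)
    have int1: "f integrable_on param_cube" if "trig_poly f" for f :: "real^'n \<Rightarrow> complex"
      unfolding cube(1) by (intro integrable_continuous continuous_on_trig_poly that)
    have int2: "(\<lambda>(\<theta>, \<theta>'). f (of_int_mat B *v (\<theta>' - \<theta>))) integrable_on (param_cube \<times> param_cube)"
      if "trig_poly f" for f
      unfolding cube(2) case_prod_beta by (intro integrable_continuous cont that)
    show ?case
      using integral_add[OF int1[OF add.hyps(1)] int1[OF add.hyps(2)]]
        integral_add[OF int2[OF add.hyps(1)] int2[OF add.hyps(2)]] add.IH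
      by (simp add: case_prod_beta distrib_left)
  qed
qed

subsection \<open>The frame potential as a return probability\<close>

lemma diag_mult:
  fixes a b :: "'d::finite \<Rightarrow> complex"
  shows "(\<chi> x y. if x = y then a x else 0) ** (\<chi> x y. if x = y then b x else 0) =
    (\<chi> x y. if x = y then a x * b x else 0)"
  by (simp add: vec_eq_iff matrix_matrix_mult_def mult_delta_left)

lemma diag_vector_mult:
  fixes a :: "'d::finite \<Rightarrow> complex"
  shows "((\<chi> x y. if x = y then a x else 0) *v v) $ x = a x * v $ x"
  by (simp add: matrix_vector_mult_def mult_delta_left)

lemma diag_power:
  fixes a :: "'d::finite \<Rightarrow> complex"
  shows "((**) (\<chi> x y. if x = y then a x else 0) ^^ m) (mat 1) = (\<chi> x y. if x = y then a x ^ m else 0)"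
proof (induction m)
  case (Suc m)
  show ?case
    unfolding funpow.simps o_def Suc.IH diag_mult by (simp add: vec_eq_iff)
qed (simp add: mat_def vec_eq_iff)

lemma mat_exp_diag:
  fixes a :: "'d::finite \<Rightarrow> complex"
  shows "mat_exp (\<chi> x y. if x = y then a x else 0) = (\<chi> x y. if x = y then exp (a x) else 0)"
proof -
  have "(\<lambda>m. (1 / fact m) *\<^sub>R (\<chi> x y. if x = y then a x ^ m else 0)) sums
      (\<chi> x y. if x = y then exp (a x) else 0)"
    unfolding sums_def
  proof (intro vec_tendstoI)
    fix x y
    have "(\<lambda>n. (\<Sum>m<n. (1 / fact m) *\<^sub>R (a x ^ m))) \<longlonglongrightarrow> exp (a x)"
      using exp_converges[of "a x"] by (simp add: sums_def inverse_eq_divide)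
    then show "(\<lambda>n. (\<Sum>m<n. (1 / fact m) *\<^sub>R (\<chi> x y. if x = y then a x ^ m else 0)) $ x $ y)
        \<longlonglongrightarrow> (\<chi> x y. if x = y then exp (a x) else 0) $ x $ y"
      by (cases "x = y") simp_all
  qed
  then show ?thesis
    unfolding mat_exp_def diag_power by (rule sums_unique[symmetric])
qed

lemma circuit_eq:
  "circuit k \<theta> = (\<chi> x y. if x = y then cis (of_int_vec (k x) \<bullet> \<theta>) else 0)"
proof -
  have "cscale_mat \<i> (\<Sum>j\<in>UNIV. (\<theta> $ j) *\<^sub>R Ham k j) =
      (\<chi> x y. if x = y then \<i> * of_real (of_int_vec (k x) \<bullet> \<theta>) else 0)"
    by (auto simp: vec_eq_iff cscale_mat_def Ham_def inner_vec_def)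
       (simp add: scaleR_conv_of_real mult.commute)
  then show ?thesis
    by (simp only: circuit_def mat_exp_diag cis_conv_exp)
qed

lemma cis_diff: "cis (u - v) = cis u * cis (- v)"
  by (simp add: cis_mult)

text \<open>When \<open>p\<close> is a probability distribution this is |E exp (iX)|^2 = E cos (X -
  X') for an independent copy X'. Summing over pairs gives the single finite index type that the
  Laplace lemmas expect.\<close>

lemma norm_cis_sum_square:
  fixes p b :: "'d::finite \<Rightarrow> real"
  shows "(cmod (\<Sum>x\<in>UNIV. of_real (p x) * cis (b x)))\<^sup>2 =
    (\<Sum>e\<in>UNIV. p (fst e) * p (snd e) * cos (b (fst e) - b (snd e)))"
proof -
  let ?z = "\<Sum>x\<in>UNIV. of_real (p x) * cis (b x)"
  have "(cmod ?z)\<^sup>2 = Re (?z * cnj ?z)"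
    by (simp only: complex_norm_square[symmetric] Re_complex_of_real)
  also have "?z * cnj ?z = (\<Sum>x\<in>UNIV. \<Sum>y\<in>UNIV. of_real (p x * p y) * cis (b x - b y))"
    unfolding cnj_sum sum_product
    by (intro sum.cong refl) (simp add: cis_cnj cis_diff mult_ac)
  also have "Re \<dots> = (\<Sum>x\<in>UNIV. \<Sum>y\<in>UNIV. p x * p y * cos (b x - b y))"
    by simp
  also have "\<dots> = (\<Sum>e\<in>UNIV. p (fst e) * p (snd e) * cos (b (fst e) - b (snd e)))"
    by (simp add: sum.cartesian_product case_prod_beta UNIV_Times_UNIV[symmetric] del: UNIV_Times_UNIV)
  finally show ?thesis .
qed

text \<open>The circuits are diagonal, so their phases combine: only the parameter difference and
  the squared moduli of the amplitudes survive.\<close>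

lemma fidelity_eq:
  "fidelity \<psi> k \<theta> \<theta>' = (cmod (\<Sum>x\<in>UNIV. of_real ((cmod (\<psi> $ x))\<^sup>2) * cis (of_int_vec (k x) \<bullet> (\<theta>' - \<theta>))))\<^sup>2"
proof -
  have adjoint: "adjoint_mat (circuit k \<theta>) = (\<chi> x y. if x = y then cis (- (of_int_vec (k x) \<bullet> \<theta>)) else 0)"
    by (auto simp: vec_eq_iff adjoint_mat_def circuit_eq cis_cnj)
  have "((adjoint_mat (circuit k \<theta>) ** circuit k \<theta>') *v \<psi>) $ x = cis (of_int_vec (k x) \<bullet> (\<theta>' - \<theta>)) * \<psi> $ x" for x
    unfolding adjoint unfolding circuit_eq diag_mult diag_vector_mult by (simp add: inner_diff_right cis_mult)
  then have "cinner \<psi> ((adjoint_mat (circuit k \<theta>) ** circuit k \<theta>') *v \<psi>) =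
      (\<Sum>x\<in>UNIV. of_real ((cmod (\<psi> $ x))\<^sup>2) * cis (of_int_vec (k x) \<bullet> (\<theta>' - \<theta>)))"
    unfolding cinner_def complex_norm_square by (simp add: mult_ac)
  then show ?thesis
    by (simp add: fidelity_def)
qed

lemma pmf_index_pmf:
  assumes "norm \<psi> = 1"
  shows "pmf (index_pmf \<psi>) x = (cmod (\<psi> $ x))\<^sup>2"
    and "(\<Sum>x\<in>UNIV. (cmod (\<psi> $ x))\<^sup>2) = 1"
proof -
  have c: "cinner \<psi> (axis x 1) = cnj (\<psi> $ x)" for x
    by (simp add: cinner_def axis_def mult_delta_left mult_delta_right)
  show 1: "(\<Sum>x\<in>UNIV. (cmod (\<psi> $ x))\<^sup>2) = 1"
    using assms by (simp add: norm_vec_def L2_set_def)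
  then have "(\<integral>\<^sup>+x. ennreal ((cmod (\<psi> $ x))\<^sup>2) \<partial>count_space UNIV) = 1"
    by (simp add: nn_integral_count_space_finite sum_ennreal)
  then show "pmf (index_pmf \<psi>) x = (cmod (\<psi> $ x))\<^sup>2"
    unfolding index_pmf_def c by (subst pmf_embed_pmf) simp_all
qed

text \<open>Cov (K - K') = 2 Cov K for an independent copy K'.\<close>

lemma covariance_mat_K_pmf:
  fixes k :: "'d::finite \<Rightarrow> int^'N"
  assumes "norm \<psi> = 1"
  defines "p \<equiv> \<lambda>x. (cmod (\<psi> $ x))\<^sup>2"
  shows "2 * covariance_mat (K_pmf \<psi> k) $ i $ j =
    (\<Sum>e\<in>UNIV. p (fst e) * p (snd e) * of_int ((k (fst e) - k (snd e)) $ i) * of_int ((k (fst e) - k (snd e)) $ j))"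
proof -
  have E: "measure_pmf.expectation (K_pmf \<psi> k) f = (\<Sum>x\<in>UNIV. p x * f (k x))" for f :: "_ \<Rightarrow> real"
    unfolding K_pmf_def integral_map_pmf
    by (subst integral_measure_pmf_real[of UNIV]) (simp_all add: pmf_index_pmf assms mult.commute)
  have p1: "(\<Sum>x\<in>UNIV. p x) = 1"
    using pmf_index_pmf(2)[OF assms(1)] by (simp add: p_def)
  define a b where "a x = real_of_int (k x $ i)" and "b x = real_of_int (k x $ j)" for x
  define A B where "A = (\<Sum>x\<in>UNIV. p x * a x)" and "B = (\<Sum>x\<in>UNIV. p x * b x)"
  define S where "S = (\<Sum>x\<in>UNIV. p x * (a x * b x))"
  have "covariance_mat (K_pmf \<psi> k) $ i $ j = (\<Sum>x\<in>UNIV. p x * ((a x - A) * (b x - B)))"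
    unfolding covariance_mat_def E by (simp add: a_def b_def A_def B_def)
  also have "\<dots> = (\<Sum>x\<in>UNIV. p x * (a x * b x) - (p x * a x) * B - A * (p x * b x) + A * B * p x)"
    by (intro sum.cong refl) (simp add: algebra_simps)
  also have "\<dots> = S - A * B"
    by (simp add: sum.distrib sum_subtractf p1 S_def flip: sum_distrib_left sum_distrib_right A_def B_def)
  finally have cov: "covariance_mat (K_pmf \<psi> k) $ i $ j = S - A * B" .
  have "(\<Sum>e\<in>UNIV. p (fst e) * p (snd e) * of_int ((k (fst e) - k (snd e)) $ i) * of_int ((k (fst e) - k (snd e)) $ j)) =
      (\<Sum>x\<in>UNIV. \<Sum>y\<in>UNIV. p x * p y * (a x - a y) * (b x - b y))"
    by (simp add: sum.cartesian_product case_prod_beta a_def b_def UNIV_Times_UNIV[symmetric] del: UNIV_Times_UNIV)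
  also have "\<dots> = (\<Sum>x\<in>UNIV. \<Sum>y\<in>UNIV. (p x * (a x * b x)) * p y - (p x * a x) * (p y * b y)
      - (p x * b x) * (p y * a y) + p x * (p y * (a y * b y)))"
    by (intro sum.cong refl) (simp add: algebra_simps)
  also have "\<dots> = S * 1 - A * B - B * A + 1 * S"
    by (simp add: sum.distrib sum_subtractf p1 S_def flip: sum_distrib_left sum_distrib_right A_def B_def)
  finally show ?thesis
    unfolding cov by simp
qed

section \<open>Integer spans and the lattice of the walk\<close>

lemma subspace_int_vec:
  assumes "0 \<in> H" "\<And>u v. u \<in> H \<Longrightarrow> v \<in> H \<Longrightarrow> u + v \<in> H" "\<And>c v. v \<in> H \<Longrightarrow> c *s v \<in> H"
  shows "module.subspace ((*s) :: int \<Rightarrow> int^'n \<Rightarrow> int^'n) H"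
  using assms unfolding module.subspace_def[OF module_int_vec] by blast

lemma int_span_rows:
  fixes B :: "int^'n^'m"
  assumes "v \<in> int_span (rows B)"
  obtains m where "v = m v* B"
proof -
  have "int_span (rows B) \<subseteq> range (\<lambda>m. m v* B)"
    unfolding int_span_def
  proof (rule module.span_minimal[OF module_int_vec])
    show "rows B \<subseteq> range (\<lambda>m. m v* B)"
    proof
      fix v assume "v \<in> rows B"
      then obtain i where "v = row i B" by (auto simp: rows_def)
      then have "v = axis i 1 v* B"
        by (simp add: vec_eq_iff vector_matrix_mult_def row_def axis_def mult_delta_left mult_delta_right)
      then show "v \<in> range (\<lambda>m. m v* B)" by blast
    qed
    show "module.subspace (*s) (range (\<lambda>m. m v* B))"
    proof (rule subspace_int_vec)
      show "0 \<in> range (\<lambda>m. m v* B)"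
        by (rule range_eqI[of _ _ 0]) (simp add: vec_eq_iff vector_matrix_mult_def)
      show "u + v \<in> range (\<lambda>m. m v* B)" if "u \<in> range (\<lambda>m. m v* B)" "v \<in> range (\<lambda>m. m v* B)" for u v
        using that by (auto simp: vector_matrix_left_distrib[symmetric])
      show "c *s v \<in> range (\<lambda>m. m v* B)" if "v \<in> range (\<lambda>m. m v* B)" for c v
      proof -
        from that obtain m where "v = m v* B" by blast
        then have "c *s v = (c *s m) v* B"
          by (simp add: vec_eq_iff vector_matrix_mult_def sum_distrib_left mult_ac)
        then show ?thesis by blast
      qed
    qed
  qed
  with assms that show ?thesis by blast
qed

text \<open>The steps of positive probability are exactly the differences over indices with nonzero
  amplitude, so these generate the lattice.\<close>

lemma walk_lattice_subset:
  assumes "norm \<psi> = 1"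
    and "\<And>x y. \<psi> $ x \<noteq> 0 \<Longrightarrow> \<psi> $ y \<noteq> 0 \<Longrightarrow> k x - k y \<in> H"
    and "module.subspace (*s) H"
  shows "walk_lattice \<psi> k \<subseteq> H"
  unfolding walk_lattice_def int_span_def
proof (rule module.span_minimal[OF module_int_vec _ assms(3)])
  have "x \<in> set_pmf (index_pmf \<psi>) \<longleftrightarrow> \<psi> $ x \<noteq> 0" for x
    by (simp add: set_pmf_iff pmf_index_pmf assms(1))
  then show "set_pmf (step_pmf \<psi> k) \<subseteq> H"
    using assms(2) by (auto simp: step_pmf_def K_pmf_def)
qed

subsection \<open>Comparison of reciprocals\<close>

text \<open>Once \<open>F t\<close> is at least half its main term, the relative error O(1/t) passes
  to the reciprocal. The finitely many earlier t enter the constant through the sum of their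
  normalized errors \<open>r t\<close>.\<close>

lemma reciprocal_asymptotics:
  fixes F :: "nat \<Rightarrow> real"
  assumes "a > 0" "C \<ge> 0" and F: "\<And>t. t > 0 \<Longrightarrow> F t > 0"
    and bound: "\<And>t. t > 0 \<Longrightarrow> \<bar>F t - a * real t powr (- \<alpha>)\<bar> \<le> C * real t powr (- \<alpha> - 1)"
  shows "\<exists>c>0. \<forall>t>0. \<bar>real t powr \<alpha> / a - 1 / F t\<bar> \<le> c * real t powr (\<alpha> - 1)"
proof -
  \<comment> \<open>From this threshold on C / t <= a / 2, so the error is at most half the main
    term.\<close>
  define T where "T = nat \<lceil>2 * C / a\<rceil>"
  define r where "r t = \<bar>real t powr \<alpha> / a - 1 / F t\<bar> / real t powr (\<alpha> - 1)" for t
  have r: "r t \<ge> 0" for t by (simp add: r_def)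
  show ?thesis
  proof (intro exI[of _ "2 * C / a\<^sup>2 + (\<Sum>t<T. r t) + 1"] conjI allI impI)
    have sum_nonneg: "(\<Sum>t<T. r t) \<ge> 0"
      by (intro sum_nonneg r)
    then show "2 * C / a\<^sup>2 + (\<Sum>t<T. r t) + 1 > 0"
      using \<open>a > 0\<close> \<open>C \<ge> 0\<close> by (simp add: add_nonneg_pos)
    fix t :: nat assume t: "t > 0"
    have "r t \<le> 2 * C / a\<^sup>2 + (\<Sum>t<T. r t)"
    proof (cases "t < T")
      case True
      then have "r t \<le> (\<Sum>t<T. r t)"
        using r by (intro member_le_sum) auto
      then show ?thesis using \<open>a > 0\<close> \<open>C \<ge> 0\<close> by (simp add: add_increasing)
    next
      case False
      then have "2 * C / a \<le> real t" unfolding T_def by linarith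
      then have Ct: "C / real t \<le> a / 2" using \<open>a > 0\<close> t by (simp add: field_simps)
      define P where "P = real t powr \<alpha>"
      have P: "P > 0" using t by (simp add: P_def)
      have powr: "real t powr (- \<alpha>) = 1 / P" "real t powr (- \<alpha> - 1) = 1 / (P * real t)"
          "real t powr (\<alpha> - 1) = P / real t"
        using t unfolding P_def powr_diff powr_minus by (simp_all add: field_simps)
      have d: "\<bar>F t - a / P\<bar> \<le> C / real t / P"
        using bound[OF t] by (simp add: powr mult.commute)
      also have "\<dots> \<le> a / 2 / P"
        using Ct P by (intro divide_right_mono) auto
      finally have "F t \<ge> a / P - a / 2 / P" by linarith
      then have lower: "F t \<ge> a / (2 * P)" by (simp add: field_simps)
      have "\<bar>P / a - 1 / F t\<bar> = \<bar>F t - a / P\<bar> * (P / a) * (1 / F t)"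
      proof -
        have "P / a - 1 / F t = (F t - a / P) * (P / a) * (1 / F t)"
          using \<open>a > 0\<close> P F[OF t] by (simp add: field_simps)
        then show ?thesis using \<open>a > 0\<close> P F[OF t] by (simp add: abs_mult)
      qed
      also have "\<dots> \<le> (C / real t / P) * (P / a) * (2 * P / a)"
      proof (intro mult_mono d)
        show "1 / F t \<le> 2 * P / a"
          using lower \<open>a > 0\<close> P F[OF t] by (simp add: field_simps)
      qed (use \<open>a > 0\<close> P F[OF t] \<open>C \<ge> 0\<close> in auto)
      also have "\<dots> = 2 * C / a\<^sup>2 * (P / real t)"
        using \<open>a > 0\<close> P by (simp add: power2_eq_square mult_ac)
      finally have "r t \<le> 2 * C / a\<^sup>2"
        using P t unfolding r_def powr P_def[symmetric] by (subst pos_divide_le_eq) auto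
      then show ?thesis using sum_nonneg by linarith
    qed
    then have "r t \<le> 2 * C / a\<^sup>2 + (\<Sum>t<T. r t) + 1" by linarith
    then show "\<bar>real t powr \<alpha> / a - 1 / F t\<bar> \<le> (2 * C / a\<^sup>2 + (\<Sum>t<T. r t) + 1) * real t powr (\<alpha> - 1)"
      using t unfolding r_def by (simp add: pos_divide_le_eq)
  qed
qed

text \<open>With m = 2^n - 1 the binomial coefficient is (m + t choose m), which is at least ((m +
  t) / m)^m and hence at least (t / m)^m.\<close>

lemma haar_frame_potential_bounds:
  assumes "1 \<le> n" "t > 0"
  shows "haar_frame_potential n t \<ge> 0"
    and "haar_frame_potential n t \<le> real (2 ^ n - 1) ^ (2 ^ n - 1) * real t powr (1 - 2 ^ n)"
proof -
  define m where "m = (2::nat) ^ n - 1"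
  have "(2::nat) ^ 1 \<le> 2 ^ n" using assms(1) by (intro power_increasing) auto
  then have m: "m \<ge> 1" "2 ^ n + t - 1 = m + t" and rm: "1 - (2::real) ^ n = - real m"
    by (auto simp: m_def of_nat_diff)
  have "real t ^ m / real m ^ m \<le> (real (m + t) / real m) ^ m"
    unfolding power_divide by (intro divide_right_mono power_mono) auto
  also have "\<dots> \<le> real ((m + t) choose m)"
    by (rule binomial_ge_n_over_k_pow_k) simp
  finally have *: "real t ^ m / real m ^ m \<le> real ((m + t) choose m)" .
  show "haar_frame_potential n t \<ge> 0"
    by (simp add: haar_frame_potential_def)
  have "haar_frame_potential n t = 1 / real ((m + t) choose m)"
    unfolding haar_frame_potential_def m(2) by (simp add: m_def)
  also have "\<dots> \<le> 1 / (real t ^ m / real m ^ m)"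
    using * m \<open>t > 0\<close> by (intro divide_left_mono) auto
  also have "\<dots> = real m ^ m * real t powr (- real m)"
    using \<open>t > 0\<close> by (simp add: powr_minus powr_realpow field_simps)
  finally show "haar_frame_potential n t \<le> real (2 ^ n - 1) ^ (2 ^ n - 1) * real t powr (1 - 2 ^ n)"
    unfolding rm by (simp add: m_def)
qed

subsection \<open>The walk in lattice coordinates\<close>

text \<open>A step is sampled by a pair of independent indices rather than by the value of the
  difference, so coinciding differences need not be merged.\<close>

definition step_weight :: "complex^'d \<Rightarrow> 'd \<times> 'd \<Rightarrow> real" where
  "step_weight \<psi> e = (cmod (\<psi> $ fst e))\<^sup>2 * (cmod (\<psi> $ snd e))\<^sup>2"

definition step_vec :: "('d \<Rightarrow> int^'N) \<Rightarrow> 'd \<times> 'd \<Rightarrow> real^'N" where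
  "step_vec m e = of_int_vec (m (fst e) - m (snd e))"

text \<open>The characteristic function of a step; it is real because exchanging the two indices
  negates the step.\<close>

definition step_char :: "complex^'d \<Rightarrow> ('d \<Rightarrow> int^'N) \<Rightarrow> real^'N \<Rightarrow> real" where
  "step_char \<psi> m \<eta> = (\<Sum>e\<in>UNIV. step_weight \<psi> e * cos (\<eta> \<bullet> step_vec m e))"

lemma step_weight_nonneg: "step_weight \<psi> e \<ge> 0"
  by (simp add: step_weight_def)

lemma sum_step_weight:
  assumes "norm \<psi> = 1"
  shows "(\<Sum>e\<in>UNIV. step_weight \<psi> e) = 1"
proof -
  have "(\<Sum>e\<in>UNIV. step_weight \<psi> e) = (\<Sum>x\<in>UNIV. \<Sum>y\<in>UNIV. (cmod (\<psi> $ x))\<^sup>2 * (cmod (\<psi> $ y))\<^sup>2)"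
    by (simp add: step_weight_def sum.cartesian_product case_prod_beta UNIV_Times_UNIV[symmetric] del: UNIV_Times_UNIV)
  also have "\<dots> = 1"
    by (simp add: pmf_index_pmf(2)[OF assms] flip: sum_distrib_left)
  finally show ?thesis .
qed

text \<open>As a squared modulus the characteristic function is nonnegative, so it has no competing
  peak at -1.\<close>

lemma step_char_eq_norm:
  "step_char \<psi> m \<eta> = (cmod (\<Sum>x\<in>UNIV. of_real ((cmod (\<psi> $ x))\<^sup>2) * cis (of_int_vec (m x) \<bullet> \<eta>)))\<^sup>2"
  unfolding norm_cis_sum_square step_char_def step_weight_def step_vec_def
  by (simp add: of_int_vec_simps inner_diff_left inner_commute[of \<eta>])

lemma step_char_nonneg: "step_char \<psi> m \<eta> \<ge> 0"
  unfolding step_char_eq_norm by simp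

lemma continuous_on_step_char: "continuous_on X (step_char \<psi> m)"
  unfolding step_char_def by (intro continuous_intros)

lemma trig_poly_step_char: "trig_poly (\<lambda>\<eta>. of_real (step_char \<psi> m \<eta> ^ t))"
proof -
  have "trig_poly (\<lambda>\<eta>. of_real (step_char \<psi> m \<eta>))"
    unfolding step_char_def step_vec_def of_real_sum of_real_mult
    by (intro trig_poly_sum trig_poly_mult trig_poly_const trig_poly_cos) simp
  then show ?thesis
    unfolding of_real_power by (rule trig_poly_power)
qed

text \<open>Pairing a step with \<theta> equals pairing its coefficient vector with
  \<open>B \<theta>\<close>. Averaging over both parameters then forgets \<open>B\<close>, and one
  of the two powers (2 pi)^N cancels.\<close>

lemma frame_potential_eq:
  fixes k m :: "'d::finite \<Rightarrow> int^'N" and B :: "int^'N^'N"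
  assumes detB: "det B \<noteq> 0" and km: "\<And>x y. k x - k y = (m x - m y) v* B"
  shows "frame_potential \<psi> k t = integral param_cube (\<lambda>\<eta>. step_char \<psi> m \<eta> ^ t) / (2 * pi) ^ CARD('N)"
proof -
  have kv: "of_int_vec (k x - k y) \<bullet> \<theta> = (of_int_mat B *v \<theta>) \<bullet> step_vec m (x, y)" for x y \<theta>
    unfolding km of_int_vec_vector_matrix_mult dot_lmul_matrix by (simp add: step_vec_def inner_commute)
  have fid: "fidelity \<psi> k \<theta> \<theta>' = step_char \<psi> m (of_int_mat B *v (\<theta>' - \<theta>))" for \<theta> \<theta>'
    unfolding fidelity_eq norm_cis_sum_square step_char_def
    by (intro sum.cong refl) (simp add: step_weight_def kv of_int_vec_simps flip: inner_diff_left of_int_vec_simps(4))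
  have cont: "continuous_on X (\<lambda>\<eta>. step_char \<psi> m \<eta> ^ t)" for X
    by (intro continuous_intros continuous_on_step_char)
  have int1: "(\<lambda>\<eta>. step_char \<psi> m \<eta> ^ t) integrable_on (param_cube :: (real^'N) set)"
    unfolding param_cube_def by (rule integrable_continuous[OF cont])
  have cont2: "continuous_on X (\<lambda>z. step_char \<psi> m (of_int_mat B *v (snd z - fst z)) ^ t)" for X
    by (rule continuous_on_compose2[OF cont[of UNIV]])
       (auto intro!: continuous_intros bounded_linear.continuous_on[OF matrix_vector_mul_bounded_linear])
  have int2: "(\<lambda>(\<theta>, \<theta>'). step_char \<psi> m (of_int_mat B *v (\<theta>' - \<theta>)) ^ t) integrable_on
      (param_cube \<times> param_cube :: ((real^'N) \<times> (real^'N)) set)"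
    unfolding param_cube_def cbox_Pair_eq[symmetric] case_prod_beta
    by (rule integrable_continuous[OF cont2])
  \<comment> \<open>The detour through complex values is needed because trigonometric polynomials
    are complex valued.\<close>
  have "complex_of_real (integral (param_cube \<times> param_cube) (\<lambda>(\<theta>, \<theta>'). step_char \<psi> m (of_int_mat B *v (\<theta>' - \<theta>)) ^ t)) =
      integral (param_cube \<times> param_cube) (\<lambda>(\<theta>, \<theta>'). of_real (step_char \<psi> m (of_int_mat B *v (\<theta>' - \<theta>)) ^ t))"
    by (subst integral_unique[OF has_integral_of_real[OF integrable_integral[OF int2]], symmetric])
       (simp add: case_prod_unfold)
  also have "\<dots> = of_real (2 * pi) ^ CARD('N) * integral param_cube (\<lambda>\<eta>. of_real (step_char \<psi> m \<eta> ^ t))"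
    by (rule trig_poly_double_integral[OF trig_poly_step_char detB])
  also have "integral param_cube (\<lambda>\<eta>. complex_of_real (step_char \<psi> m \<eta> ^ t)) =
      of_real (integral param_cube (\<lambda>\<eta>. step_char \<psi> m \<eta> ^ t))"
    by (rule integral_unique[OF has_integral_of_real[OF integrable_integral[OF int1]]])
  finally have "complex_of_real (integral (param_cube \<times> param_cube) (\<lambda>(\<theta>, \<theta>'). step_char \<psi> m (of_int_mat B *v (\<theta>' - \<theta>)) ^ t)) =
      complex_of_real ((2 * pi) ^ CARD('N) * integral param_cube (\<lambda>\<eta>. step_char \<psi> m \<eta> ^ t))"
    by simp
  then have "integral (param_cube \<times> param_cube) (\<lambda>(\<theta>, \<theta>'). step_char \<psi> m (of_int_mat B *v (\<theta>' - \<theta>)) ^ t) =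
      (2 * pi) ^ CARD('N) * integral param_cube (\<lambda>\<eta>. step_char \<psi> m \<eta> ^ t)"
    by (simp only: of_real_eq_iff)
  then show ?thesis
    unfolding frame_potential_def fid mult_2[of "CARD('N)"] power_add by simp
qed

text \<open>The integrand is continuous, nonnegative and equal to 1 at the origin.\<close>

lemma integral_step_char_power_pos:
  fixes m :: "'d::finite \<Rightarrow> int^'N"
  assumes "norm \<psi> = 1"
  shows "integral param_cube (\<lambda>\<eta>. step_char \<psi> m \<eta> ^ t) > 0"
proof -
  let ?f = "\<lambda>\<eta> :: real^'N. step_char \<psi> m \<eta> ^ t"
  have cont: "continuous_on X ?f" for X
    by (intro continuous_intros continuous_on_step_char)
  have "step_char \<psi> m 0 = 1"
    by (simp add: step_char_def sum_step_weight assms)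
  moreover have "(0 :: real^'N) \<in> param_cube"
    by (simp add: mem_param_cube)
  moreover have "box (\<chi> j. - pi) (\<chi> j. pi) \<noteq> ({} :: (real^'N) set)"
    by (simp add: interval_ne_empty_cart)
  ultimately have "integral param_cube ?f \<noteq> 0"
    unfolding param_cube_def
    by (subst integral_cbox_eq_0_iff[OF cont]) (auto intro!: bexI[of _ 0] simp: step_char_nonneg)
  moreover have "integral param_cube ?f \<ge> 0"
    unfolding param_cube_def
    by (intro integral_nonneg integrable_continuous cont) (simp add: step_char_nonneg)
  ultimately show ?thesis by simp
qed

text \<open>A point \<open>\<eta> = B \<theta>\<close> with \<open>step_char \<psi> m \<eta> = 1\<close> pairs every step of the walk, hence every row of
  \<open>B\<close>, with \<open>\<theta>\<close> to a multiple of \<open>2 \<pi>\<close>.\<close>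

lemma step_char_eq_1_imp_0:
  fixes k m :: "'d::finite \<Rightarrow> int^'N" and B :: "int^'N^'N"
  assumes \<psi>: "norm \<psi> = 1" and detB: "det B \<noteq> 0"
    and km: "\<And>x y. k x - k y = (m x - m y) v* B"
    and lattice: "int_span (rows B) = walk_lattice \<psi> k"
    and \<eta>: "\<eta> \<in> param_cube" "step_char \<psi> m \<eta> = 1"
  shows "\<eta> = 0"
proof -
  obtain \<theta> where \<theta>: "of_int_mat B *v \<theta> = \<eta>"
    using detB by (rule of_int_mat_surj)
  \<comment> \<open>Membership in \<open>H\<close> is stable under integer combinations, so it
    spreads from the steps of positive probability to the lattice and thus to the rows of
    \<open>B\<close>.\<close>
  define H where "H = {d :: int^'N. \<exists>j::int. of_int_vec d \<bullet> \<theta> = of_int j * 2 * pi}"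
  have cos1: "cos (\<eta> \<bullet> step_vec m e) = 1" if "step_weight \<psi> e \<noteq> 0" for e
  proof -
    \<comment> \<open>A weighted mean of cosines is 1 only if every cosine of positive weight is
      1.\<close>
    have sum0: "(\<Sum>e\<in>UNIV. step_weight \<psi> e * (1 - cos (\<eta> \<bullet> step_vec m e))) = 0"
      using \<eta>(2) by (simp add: right_diff_distrib sum_subtractf sum_step_weight[OF \<psi>] step_char_def)
    have "step_weight \<psi> e * (1 - cos (\<eta> \<bullet> step_vec m e)) = 0"
      by (rule sum_nonneg_0[OF finite _ sum0 UNIV_I]) (simp add: step_weight_nonneg)
    with that show ?thesis by simp
  qed
  have "walk_lattice \<psi> k \<subseteq> H"
  proof (rule walk_lattice_subset[OF \<psi>])
    fix x y assume "\<psi> $ x \<noteq> 0" "\<psi> $ y \<noteq> 0"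
    then have "cos (\<eta> \<bullet> step_vec m (x, y)) = 1"
      by (intro cos1) (simp add: step_weight_def)
    moreover have "of_int_vec (k x - k y) \<bullet> \<theta> = \<eta> \<bullet> step_vec m (x, y)"
      unfolding km of_int_vec_vector_matrix_mult dot_lmul_matrix \<theta> by (simp add: step_vec_def inner_commute)
    ultimately show "k x - k y \<in> H"
      by (simp add: H_def cos_one_2pi_int)
  next
    show "module.subspace (*s) H"
    proof (rule subspace_int_vec)
      show "0 \<in> H" by (simp add: H_def of_int_vec_simps)
    next
      fix u v assume "u \<in> H" "v \<in> H"
      then obtain a b :: int where "of_int_vec u \<bullet> \<theta> = of_int a * 2 * pi" "of_int_vec v \<bullet> \<theta> = of_int b * 2 * pi"
        by (auto simp: H_def)
      then have "of_int_vec (u + v) \<bullet> \<theta> = of_int (a + b) * 2 * pi"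
        by (simp add: of_int_vec_simps inner_add_left algebra_simps)
      then show "u + v \<in> H" unfolding H_def by blast
    next
      fix c and v assume "v \<in> H"
      then obtain a :: int where a: "of_int_vec v \<bullet> \<theta> = of_int a * 2 * pi"
        by (auto simp: H_def)
      have "of_int_vec (c *s v) = of_int c *\<^sub>R of_int_vec v"
        by (simp add: vec_eq_iff)
      then have "of_int_vec (c *s v) \<bullet> \<theta> = of_int (c * a) * 2 * pi"
        using a by simp
      then show "c *s v \<in> H" unfolding H_def by blast
    qed
  qed
  moreover have "rows B \<subseteq> int_span (rows B)"
    unfolding int_span_def using module.span_superset[OF module_int_vec] .
  ultimately have rows: "row i B \<in> H" for i
    unfolding lattice by (auto simp: rows_def)
  have "\<eta> $ i = 0" for i
  proof -
    obtain j :: int where j: "of_int_vec (row i B) \<bullet> \<theta> = of_int j * 2 * pi"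
      using rows[of i] by (auto simp: H_def)
    have "\<eta> $ i = of_int_vec (row i B) \<bullet> \<theta>"
      unfolding \<theta>[symmetric] by (simp add: matrix_vector_mult_def inner_vec_def row_def)
    then have eq: "\<eta> $ i = of_int j * 2 * pi" using j by simp
    have "\<bar>\<eta> $ i\<bar> \<le> pi" using \<eta>(1) by (simp add: mem_param_cube)
    \<comment> \<open>The cube has half-width pi while the candidates are multiples of 2 pi, so even
      its closed faces contain none but 0.\<close>
    then have "\<bar>real_of_int j\<bar> * 2 * pi \<le> 1 * pi" unfolding eq by (simp add: abs_mult)
    then have "\<bar>real_of_int j\<bar> * 2 \<le> 1" using pi_gt_zero mult_right_le_imp_le by blast
    then have "j = 0" by linarith
    then show ?thesis using eq by simp
  qed
  then show ?thesis by (simp add: vec_eq_iff)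
qed

text \<open>Steps are coefficient rows times \<open>B\<close>, so their covariance is
  \<open>B^T \<Sigma> B\<close>; this is where the lattice volume enters the asymptotics.\<close>

lemma det_covariance_mat:
  fixes k m :: "'d::finite \<Rightarrow> int^'N" and B :: "int^'N^'N"
  assumes \<psi>: "norm \<psi> = 1" and km: "\<And>x y. k x - k y = (m x - m y) v* B"
  defines "\<Sigma> \<equiv> \<chi> i j. \<Sum>e\<in>UNIV. step_weight \<psi> e * step_vec m e $ i * step_vec m e $ j"
  shows "2 ^ CARD('N) * det (covariance_mat (K_pmf \<psi> k)) = (of_int (det B))\<^sup>2 * det \<Sigma>"
proof -
  let ?C = "covariance_mat (K_pmf \<psi> k)" and ?R = "of_int_mat B"
  have "(\<chi> i. 2 *s (?C $ i)) = transpose ?R ** \<Sigma> ** ?R"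
  proof -
    have "2 * ?C $ i $ j = (transpose ?R ** \<Sigma> ** ?R) $ i $ j" for i j
    proof -
      have k: "real_of_int ((k (fst e) - k (snd e)) $ i) = (\<Sum>a\<in>UNIV. step_vec m e $ a * ?R $ a $ i)" for e i
        unfolding km by (simp add: step_vec_def vector_matrix_mult_def mult.commute)
      have "2 * ?C $ i $ j = (\<Sum>e\<in>UNIV. step_weight \<psi> e * (\<Sum>a\<in>UNIV. step_vec m e $ a * ?R $ a $ i) * (\<Sum>b\<in>UNIV. step_vec m e $ b * ?R $ b $ j))"
        unfolding covariance_mat_K_pmf[OF \<psi>] k step_weight_def ..
      also have "\<dots> = (\<Sum>e\<in>UNIV. \<Sum>b\<in>UNIV. \<Sum>a\<in>UNIV. ?R $ a $ i * (step_weight \<psi> e * step_vec m e $ a * step_vec m e $ b) * ?R $ b $ j)"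
        unfolding sum_distrib_left sum_distrib_right by (simp only: mult_ac)
      also have "\<dots> = (\<Sum>b\<in>UNIV. \<Sum>a\<in>UNIV. \<Sum>e\<in>UNIV. ?R $ a $ i * (step_weight \<psi> e * step_vec m e $ a * step_vec m e $ b) * ?R $ b $ j)"
        by (subst sum.swap, intro sum.cong refl, rule sum.swap)
      also have "\<dots> = (\<Sum>b\<in>UNIV. (\<Sum>a\<in>UNIV. ?R $ a $ i * \<Sigma> $ a $ b) * ?R $ b $ j)"
        by (simp add: \<Sigma>_def sum_distrib_left sum_distrib_right)
      also have "\<dots> = (transpose ?R ** \<Sigma> ** ?R) $ i $ j"
        by (simp add: matrix_matrix_mult_def transpose_def)
      finally show ?thesis .
    qed
    then show ?thesis by (simp add: vec_eq_iff)
  qed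
  then have "det (\<chi> i. 2 *s (?C $ i)) = (of_int (det B))\<^sup>2 * det \<Sigma>"
    by (simp add: det_mul det_transpose det_of_int_mat power2_eq_square)
  then show ?thesis
    unfolding det_rows_mul by simp
qed

theorem corollary2:
  fixes n :: nat
    and \<psi> :: "complex ^ 'd"
    and k :: "'d \<Rightarrow> int ^ 'N"
    and B :: "int ^ 'N ^ 'N"
  assumes "1 \<le> n" and "n \<le> CARD('N)" and "CARD('d) = 2 ^ n"
    and "norm \<psi> = 1"
    and "inj (Ham k)" and "independent (range (Ham k))"
    and "walk_lattice \<psi> k = int_span (Delta k)"
    and "rows B \<subseteq> Delta k" and "int_span (rows B) = walk_lattice \<psi> k"
    and "det B \<noteq> 0"
  shows "\<exists>c>0. \<forall>t::nat. t > 0 \<longrightarrow>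
    \<bar>approx_expressiveness n \<psi> k (real_of_int \<bar>det B\<bar>) t - expressiveness n \<psi> k t\<bar>
      < c * real t powr (real CARD('N) / 2 - 2 ^ n)"
proof -
  define \<alpha> where "\<alpha> = real CARD('N) / 2"
  \<comment> \<open>Only differences of the \<open>k x\<close> lie in the lattice, so an arbitrary
    base index is subtracted. Since the lattice is the span of \<open>Delta k\<close>, indices of
    zero amplitude get coefficients as well.\<close>
  obtain m where m: "k x - k undefined = m x v* B" for x
  proof -
    have "\<exists>r. k x - k undefined = r v* B" for x
    proof -
      have "k x - k undefined \<in> int_span (rows B)"
        unfolding assms(9,7) unfolding int_span_def
        by (rule module.span_base[OF module_int_vec]) (auto simp: Delta_def)
      then show ?thesis by (rule int_span_rows) blast
    qed
    then show ?thesis using that by metis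
  qed
  have km: "k x - k y = (m x - m y) v* B" for x y
  proof -
    have "(m x - m y) v* B = m x v* B - m y v* B"
      by (simp add: vec_eq_iff vector_matrix_mult_def algebra_simps sum_subtractf)
    then show ?thesis by (simp flip: m)
  qed
  define \<Sigma> where "\<Sigma> = (\<chi> i j. \<Sum>e\<in>UNIV. step_weight \<psi> e * step_vec m e $ i * step_vec m e $ j)"
  define I where "I t = integral param_cube (\<lambda>\<eta>. step_char \<psi> m \<eta> ^ t)" for t
  have uniq: "\<eta> = 0" if "\<eta> \<in> param_cube" "step_char \<psi> m \<eta> = 1" for \<eta>
    using step_char_eq_1_imp_0[OF assms(4,10) km assms(9)] that by blast
  note laplace = cos_sum_laplace[of "step_weight \<psi>" "step_vec m", folded step_char_def \<Sigma>_def I_def,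
      OF step_weight_nonneg sum_step_weight[OF assms(4)] step_char_nonneg uniq]
  have det\<Sigma>: "det \<Sigma> > 0"
    using laplace(1) by blast
  obtain C where C: "C > 0"
    "\<And>t. t > 0 \<Longrightarrow> \<bar>I t - (2 * pi / real t) powr \<alpha> / sqrt (det \<Sigma>)\<bar> \<le> C * real t powr (- \<alpha> - 1)"
    using laplace(2) unfolding \<alpha>_def minus_divide_left by blast
  \<comment> \<open>The leading coefficient of the frame potential: (2 pi)^\<alpha> from the
    Gaussian divided by (2 pi)^N, where N = 2 \<alpha>.\<close>
  define a where "a = (2 * pi) powr (- \<alpha>) / sqrt (det \<Sigma>)"
  have a: "a > 0" using det\<Sigma> by (simp add: a_def)
  define F where "F t = frame_potential \<psi> k t" for t
  have F: "F t = I t / (2 * pi) ^ CARD('N)" for t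
    unfolding F_def I_def by (rule frame_potential_eq[OF assms(10) km])
  have pi_pow: "(2 * pi) ^ CARD('N) = (2 * pi) powr \<alpha> * (2 * pi) powr \<alpha>"
    by (simp add: \<alpha>_def powr_realpow flip: powr_add)
  have "\<exists>c>0. \<forall>t>0. \<bar>real t powr \<alpha> / a - 1 / F t\<bar> \<le> c * real t powr (\<alpha> - 1)"
  proof (rule reciprocal_asymptotics[OF a, of "C / (2 * pi) ^ CARD('N)"])
    show "C / (2 * pi) ^ CARD('N) \<ge> 0" using C by simp
    show "F t > 0" for t
      unfolding F I_def using integral_step_char_power_pos[OF assms(4), of m t] by simp
    fix t :: nat assume t: "t > 0"
    have "a * real t powr (- \<alpha>) = ((2 * pi / real t) powr \<alpha> / sqrt (det \<Sigma>)) / (2 * pi) ^ CARD('N)"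
    proof -
      have cancel: "inverse X / S * inverse T = X / T / S / (X * X)" if "X \<noteq> 0" for X S T :: real
        using that by (simp add: divide_simps)
      have split: "(2 * pi / real t) powr \<alpha> = (2 * pi) powr \<alpha> / real t powr \<alpha>"
        using t by (simp add: powr_divide)
      show ?thesis
        unfolding a_def pi_pow powr_minus split by (rule cancel) simp
    qed
    then have "F t - a * real t powr (- \<alpha>) = (I t - (2 * pi / real t) powr \<alpha> / sqrt (det \<Sigma>)) / (2 * pi) ^ CARD('N)"
      by (simp add: F diff_divide_distrib)
    then show "\<bar>F t - a * real t powr (- \<alpha>)\<bar> \<le> C / (2 * pi) ^ CARD('N) * real t powr (- \<alpha> - 1)"
      using C(2)[OF t] by (simp add: divide_right_mono)
  qed
  then obtain c where c: "c > 0" "\<And>t. t > 0 \<Longrightarrow> \<bar>real t powr \<alpha> / a - 1 / F t\<bar> \<le> c * real t powr (\<alpha> - 1)"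
    by blast
  have sqrt_cov: "sqrt (det (covariance_mat (K_pmf \<psi> k))) / real_of_int \<bar>det B\<bar> = sqrt (det \<Sigma>) / 2 powr \<alpha>"
  proof -
    have two: "(2::real) ^ CARD('N) = (2 powr \<alpha>)\<^sup>2"
      by (simp add: \<alpha>_def powr_realpow power2_eq_square flip: powr_add)
    have "2 ^ CARD('N) * det (covariance_mat (K_pmf \<psi> k)) = (of_int (det B))\<^sup>2 * det \<Sigma>"
      unfolding \<Sigma>_def by (rule det_covariance_mat[OF assms(4) km])
    then have "det (covariance_mat (K_pmf \<psi> k)) = (of_int (det B) / 2 powr \<alpha>)\<^sup>2 * det \<Sigma>"
      unfolding two by (simp add: field_simps power_divide)
    then show ?thesis
      using assms(10) by (simp add: real_sqrt_mult real_sqrt_abs abs_divide)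
  qed
  have approx: "approx_expressiveness n \<psi> k (real_of_int \<bar>det B\<bar>) t = real t powr \<alpha> / a * haar_frame_potential n t" for t
  proof -
    have "(4 * pi * real t) powr \<alpha> = 2 powr \<alpha> * (2 * pi) powr \<alpha> * real t powr \<alpha>"
      by (simp flip: powr_mult)
    then show ?thesis
      unfolding approx_expressiveness_def sqrt_cov \<alpha>_def[symmetric]
      by (simp add: a_def powr_minus field_simps)
  qed
  define D where "D = real (2 ^ n - 1) ^ (2 ^ n - 1)"
  show ?thesis
  \<comment> \<open>\<open>D\<close> bounds the Haar factor and \<open>c\<close> the error of the
    reciprocal; the added 1 makes the inequality strict.\<close>
  proof (intro exI[of _ "D * c + 1"] conjI allI impI)
    show "D * c + 1 > 0"
      using c(1) by (simp add: D_def add_nonneg_pos)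
    fix t :: nat assume t: "t > 0"
    note haar = haar_frame_potential_bounds[OF assms(1) t]
    have "approx_expressiveness n \<psi> k (real_of_int \<bar>det B\<bar>) t - expressiveness n \<psi> k t =
        haar_frame_potential n t * (real t powr \<alpha> / a - 1 / F t)"
      unfolding approx by (simp add: expressiveness_def F_def algebra_simps)
    then have "\<bar>approx_expressiveness n \<psi> k (real_of_int \<bar>det B\<bar>) t - expressiveness n \<psi> k t\<bar> =
        haar_frame_potential n t * \<bar>real t powr \<alpha> / a - 1 / F t\<bar>"
      using haar(1) by (simp add: abs_mult)
    also have "\<dots> \<le> (D * real t powr (1 - 2 ^ n)) * (c * real t powr (\<alpha> - 1))"
      using haar c(2)[OF t] by (intro mult_mono) (auto simp: D_def)
    also have "\<dots> = D * c * real t powr (\<alpha> - 2 ^ n)"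
      by (simp flip: powr_add)
    also have "\<dots> < (D * c + 1) * real t powr (\<alpha> - 2 ^ n)"
      using t by (intro mult_strict_right_mono) auto
    finally show "\<bar>approx_expressiveness n \<psi> k (real_of_int \<bar>det B\<bar>) t - expressiveness n \<psi> k t\<bar>
        < (D * c + 1) * real t powr (real CARD('N) / 2 - 2 ^ n)"
      unfolding \<alpha>_def .
  qed
qed

end
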